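(* Let $\mathsf P$ be a piece with basic move set $\mathcal M$, $\mathcal B$ a rational convex polygon, and $q\ge1$. Let $p$ be the period of the quasipolynomial $u_{\mathsf P}(q;n)$ (as a function of $n$), and let $u_{\mathsf P,-1}(q;n)$ be the polynomial in $n$ that agrees with $u_{\mathsf P}(q;n)$ for all positive integers $n\equiv -1\pmod p$; define $o_{\mathsf P,-1}(q;n)$ likewise from $o_{\mathsf P}(q;n)$. Then the number of unlabelled combinatorial types of nonattacking configuration of $q$ pieces $\mathsf P$ equals $u_{\mathsf P,-1}(q;-1)$, and the number of labelled nonattacking configuration types equals $o_{\mathsf P,-1}(q;-1)$.
   Context: $\mathcal M$ is a nonempty finite set of nonzero vectors $m_r=(c_r,d_r)\in\mathbb Z^2$ with $\gcd(c_r,d_r)=1$, no two parallel; $m_r^\perp=(d_r,-c_r)$. $\mathcal B\subset\mathbb R^2$ is a closed two-dimensional convex polygon with rational vertices and interior $\mathcal B^\circ$. For $t=n+1$ a positive integer, a labelled configuration is $\mathbf z=(z_1,\dots,z_q)$, $z_i\in t\mathcal B^\circ\cap\mathbb Z^2$, nonattacking if $(z_j-z_i)\cdot m_r^\perp\ne 0$ for all $i\ne j$ and all $r$; $o_{\mathsf P}(q;n)$ counts them and $u_{\mathsf P}(q;n)=o_{\mathsf P}(q;n)/q!$ counts nonattacking unlabelled configurations; both are quasipolynomials in $n$. The labelled type of a nonattacking configuration is the family of sets $L_{ir}=\{j:(z_j-z_i)\cdot m_r^\perp>0\}$, $i=1,\dots,q$, $m_r\in\mathcal M$; labelled nonattacking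 configuration types are those realized for some $t$; unlabelled types are obtained by forgetting the labels (orbits under permutation of the pieces). *)

theory Defs
  imports "HOL-Analysis.Analysis" "HOL-Number_Theory.Cong" "HOL-Combinatorics.Permutations"
begin

section \<open>Pieces and boards\<close>

definition perp :: "int \<times> int \<Rightarrow> int \<times> int" where
  "perp m = (snd m, - fst m)"

definition dot :: "int \<times> int \<Rightarrow> int \<times> int \<Rightarrow> int" where
  "dot x y = fst x * fst y + snd x * snd y"

definition basic_move_set :: "(int \<times> int) set \<Rightarrow> bool" where
  "basic_move_set M \<longleftrightarrow> finite M \<and> M \<noteq> {} \<and> (\<forall>(c, d)\<in>M. (c, d) \<noteq> (0, 0) \<and> gcd c d = 1) \<and>
     (\<forall>(c, d)\<in>M. \<forall>(c', d')\<in>M. (c, d) \<noteq> (c', d') \<longrightarrow> c * d' - d * c' \<noteq> 0)"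

definition rational_convex_polygon :: "(real \<times> real) set \<Rightarrow> bool" where
  "rational_convex_polygon B \<longleftrightarrow> polytope B \<and> aff_dim B = 2 \<and>
     (\<forall>v. v extreme_point_of B \<longrightarrow> fst v \<in> \<rat> \<and> snd v \<in> \<rat>)"

definition interior_lattice_points :: "(real \<times> real) set \<Rightarrow> nat \<Rightarrow> (int \<times> int) set" where
  "interior_lattice_points B t =
     {z. (of_int (fst z), of_int (snd z)) \<in> (\<lambda>x. real t *\<^sub>R x) ` interior B}"

section \<open>Configurations and their types\<close>

definition nonattacking_configs ::
    "(int \<times> int) set \<Rightarrow> (real \<times> real) set \<Rightarrow> nat \<Rightarrow> nat \<Rightarrow> (nat \<Rightarrow> int \<times> int) set" where
  "nonattacking_configs M B q t =
     {z \<in> {1..q} \<rightarrow>\<^sub>E interior_lattice_points B t.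
        \<forall>i\<in>{1..q}. \<forall>j\<in>{1..q}. i \<noteq> j \<longrightarrow> (\<forall>m\<in>M. dot (z j - z i) (perp m) \<noteq> 0)}"

definition labelled_count ::
    "(int \<times> int) set \<Rightarrow> (real \<times> real) set \<Rightarrow> nat \<Rightarrow> nat \<Rightarrow> real" where
  "labelled_count M B q n = real (card (nonattacking_configs M B q (n + 1)))"

definition unlabelled_count ::
    "(int \<times> int) set \<Rightarrow> (real \<times> real) set \<Rightarrow> nat \<Rightarrow> nat \<Rightarrow> real" where
  "unlabelled_count M B q n = labelled_count M B q n / fact q"

type_synonym config_type = "nat \<Rightarrow> int \<times> int \<Rightarrow> nat set"

definition labelled_type ::
    "(int \<times> int) set \<Rightarrow> nat \<Rightarrow> (nat \<Rightarrow> int \<times> int) \<Rightarrow> config_type" where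
  "labelled_type M q z =
     (\<lambda>i\<in>{1..q}. \<lambda>m\<in>M. {j \<in> {1..q}. dot (z j - z i) (perp m) > 0})"

definition labelled_types ::
    "(int \<times> int) set \<Rightarrow> (real \<times> real) set \<Rightarrow> nat \<Rightarrow> config_type set" where
  "labelled_types M B q = (\<Union>t\<in>{1..}. labelled_type M q ` nonattacking_configs M B q t)"

text \<open>The action of a permutation of the pieces on types; \<open>labelled_type_comp\<close> shows that it is
  the action induced by relabelling configurations.\<close>

definition relabel ::
    "(int \<times> int) set \<Rightarrow> nat \<Rightarrow> (nat \<Rightarrow> nat) \<Rightarrow> config_type \<Rightarrow> config_type" where
  "relabel M q \<sigma> L = (\<lambda>i\<in>{1..q}. \<lambda>m\<in>M. \<sigma> -` L (\<sigma> i) m)"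

lemma labelled_type_comp:
  assumes "\<sigma> permutes {1..q}"
  shows "labelled_type M q (z \<circ> \<sigma>) = relabel M q \<sigma> (labelled_type M q z)"
proof -
  have "\<sigma> i \<in> {1..q} \<longleftrightarrow> i \<in> {1..q}" for i
    using permutes_in_image[OF assms] .
  then show ?thesis
    unfolding labelled_type_def relabel_def
    by (intro restrict_ext) (auto simp: fun_eq_iff restrict_def)
qed

definition unlabelled_types ::
    "(int \<times> int) set \<Rightarrow> (real \<times> real) set \<Rightarrow> nat \<Rightarrow> config_type set set" where
  "unlabelled_types M B q =
     (\<lambda>L. {relabel M q \<sigma> L | \<sigma>. \<sigma> permutes {1..q}}) ` labelled_types M B q"

section \<open>Quasipolynomials\<close>

definition quasipolynomial_with_period :: "(nat \<Rightarrow> real) \<Rightarrow> nat \<Rightarrow> bool" where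
  "quasipolynomial_with_period f p \<longleftrightarrow>
     p > 0 \<and> (\<exists>Q :: nat \<Rightarrow> real poly. \<forall>n. f n = poly (Q (n mod p)) (real n))"

definition quasipolynomial_period :: "(nat \<Rightarrow> real) \<Rightarrow> nat" where
  "quasipolynomial_period f = (LEAST p. quasipolynomial_with_period f p)"

definition agrees_on_class :: "(nat \<Rightarrow> real) \<Rightarrow> nat \<Rightarrow> int \<Rightarrow> real poly \<Rightarrow> bool" where
  "agrees_on_class f p r Q \<longleftrightarrow>
     (\<forall>n>0. [int n = r] (mod int p) \<longrightarrow> poly Q (real n) = f n)"

definition constituent :: "(nat \<Rightarrow> real) \<Rightarrow> nat \<Rightarrow> int \<Rightarrow> real poly" where
  "constituent f p r = (THE Q. agrees_on_class f p r Q)"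

lemma agrees_on_class_unique:
  assumes "p > 0" "agrees_on_class f p r Q" "agrees_on_class f p r R"
  shows "Q = R"
proof -
  define g where "g k = nat (r mod int p) + p * Suc k" for k
  have g: "g k > 0" "[int (g k) = r] (mod int p)" for k
    using \<open>p > 0\<close> by (auto simp: g_def cong_def mod_mult_right_eq simp del: mult_Suc_right)
  have "inj (\<lambda>k. real (g k))"
    using \<open>p > 0\<close> by (auto simp: inj_on_def g_def)
  then have "infinite (range (\<lambda>k. real (g k)))"
    using finite_imageD by blast
  moreover have "range (\<lambda>k. real (g k)) \<subseteq> {x. poly (Q - R) x = 0}"
    using assms g by (auto simp: agrees_on_class_def)
  ultimately have "Q - R = 0"
    using poly_roots_finite finite_subset by blast
  then show ?thesis by simp
qed

lemma agrees_on_class_constituent: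
  assumes "quasipolynomial_with_period f p"
  shows "agrees_on_class f p r (constituent f p r)"
proof -
  obtain Q :: "nat \<Rightarrow> real poly" where p: "p > 0" and Q: "\<And>n. f n = poly (Q (n mod p)) (real n)"
    using assms by (auto simp: quasipolynomial_with_period_def)
  have "n mod p = nat (r mod int p)" if "[int n = r] (mod int p)" for n
    using that by (metis cong_def nat_int zmod_int)
  then have Q': "agrees_on_class f p r (Q (nat (r mod int p)))"
    unfolding agrees_on_class_def using Q by metis
  show ?thesis
    unfolding constituent_def using Q' agrees_on_class_unique[OF p _ Q'] by (rule theI)
qed

end

theory Submission
  imports Defs "HOL-Library.Function_Algebras"
begin

text \<open>
  A labelled type is an open region of the arrangement of attacking hyperplanes inside the open
  polytope formed by the \<open>q\<close>-fold power of the interior of \<open>B\<close>, and the configurations of this type for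
  the dilation factor \<open>t\<close> are the lattice points of height \<open>t\<close> in the open cone over the region. Hence it
  suffices that the Ehrhart quasipolynomial of an open rational polytope of dimension \<open>d\<close> has the value
  \<open>(-1) ^ d\<close> at \<open>t = 0\<close>: here \<open>d = 2 * q\<close> is even, every region contributes \<open>1\<close>, and \<open>t = 0\<close> is \<open>n = -1\<close>.

  For the relatively open simplicial cone on \<open>k\<close> generators the value is \<open>- ((-1) ^ k)\<close>, by an explicit count.
  An open cone is cut into simplicial ones by stellar subdivision of edges along its bounding
  hyperplanes. The sum of \<open>(-1) ^ k\<close> over all cells depends only on the dimension: by induction it is
  known on the slices on which a coordinate is \<open>s\<close> times the height, and it is recovered from them by an
  Euler integral over the real variable \<open>s\<close>.

  Unlabelled types are counted by orbits, since the symmetric group acts freely on labelled types.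
\<close>

section \<open>Simplicial cones\<close>

text \<open>Cones spanned with strictly positive coefficients are relatively open, so a subdivision
  is an exact disjoint union and lattice points add without inclusion-exclusion. The price is that
  cells of every dimension count. The value \<open>- ((-1) ^ k)\<close> of a cell on k generators
  is, up to sign, its Euler characteristic with compact support, as the cell is a copy of real
  k-space. The total must therefore depend on the open cone alone, but it has to be found without
  knowing which cells the cuts leave behind; the Euler integral over slopes does this. For the open
  cone over a d-dimensional polytope it gives \<open>(-1) ^ (d + 1)\<close>, whence the value
  \<open>(-1) ^ d\<close>.

  The edge point used for a cut is \<open>g u *\<^sub>R v - g v *\<^sub>R u\<close>, without
  normalisation, so integral generators stay integral under an integral functional. The slices of
  the Euler integral sit at arbitrary real slopes and leave the lattice; so one and the same
  partition is read twice, with integral generators for counting and with generators merely of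
  positive height for the Euler sum.\<close>

definition rcone :: "'v::real_vector set \<Rightarrow> 'v set" where
  "rcone V = {\<Sum>v\<in>V. a v *\<^sub>R v | a. \<forall>v\<in>V. a v > 0}"

lemma rconeI: "(\<And>v. v \<in> V \<Longrightarrow> a v > 0) \<Longrightarrow> (\<Sum>v\<in>V. a v *\<^sub>R v) \<in> rcone V"
  unfolding rcone_def by blast

lemma rcone_nonempty: "rcone V \<noteq> {}"
  using rconeI[of V "\<lambda>_. 1"] by auto

lemma rcone_empty [simp]: "rcone {} = {0}"
  by (auto simp: rcone_def)

lemma rcone_subset_span: "rcone V \<subseteq> span V"
  unfolding rcone_def by (auto intro: span_sum span_scale span_base)

lemma rcone_insert:
  assumes "finite V" "v \<notin> V"
  shows "x \<in> rcone (insert v V) \<longleftrightarrow> (\<exists>a y. a > 0 \<and> y \<in> rcone V \<and> x = a *\<^sub>R v + y)"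
proof
  assume "x \<in> rcone (insert v V)"
  then obtain c where "\<forall>w\<in>insert v V. c w > 0" "x = (\<Sum>w\<in>insert v V. c w *\<^sub>R w)"
    unfolding rcone_def by blast
  then show "\<exists>a y. a > 0 \<and> y \<in> rcone V \<and> x = a *\<^sub>R v + y"
    using assms by (intro exI[of _ "c v"] exI[of _ "\<Sum>w\<in>V. c w *\<^sub>R w"]) (auto intro!: rconeI)
next
  assume "\<exists>a y. a > 0 \<and> y \<in> rcone V \<and> x = a *\<^sub>R v + y"
  then obtain a c where ac: "a > 0" "\<forall>w\<in>V. c w > 0" "x = a *\<^sub>R v + (\<Sum>w\<in>V. c w *\<^sub>R w)"
    unfolding rcone_def by blast
  have "(\<Sum>w\<in>V. c w *\<^sub>R w) = (\<Sum>w\<in>V. (c(v := a)) w *\<^sub>R w)"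
    using assms by (intro sum.cong) auto
  then have x: "x = (\<Sum>w\<in>insert v V. (c(v := a)) w *\<^sub>R w)"
    using ac assms by simp
  show "x \<in> rcone (insert v V)"
    unfolding x using ac by (intro rconeI) auto
qed

lemma rcone_insert2:
  assumes "finite W" "u \<notin> W" "v \<notin> W" "u \<noteq> v"
  shows "x \<in> rcone (insert u (insert v W)) \<longleftrightarrow>
    (\<exists>a b y. a > 0 \<and> b > 0 \<and> y \<in> rcone W \<and> x = a *\<^sub>R u + b *\<^sub>R v + y)"
proof
  assume "x \<in> rcone (insert u (insert v W))"
  then obtain a z where az: "a > 0" "z \<in> rcone (insert v W)" "x = a *\<^sub>R u + z"
    using rcone_insert[of "insert v W" u x] assms by auto
  then obtain b y where "b > 0" "y \<in> rcone W" "z = b *\<^sub>R v + y"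
    using rcone_insert[of W v z] assms by auto
  then show "\<exists>a b y. a > 0 \<and> b > 0 \<and> y \<in> rcone W \<and> x = a *\<^sub>R u + b *\<^sub>R v + y"
    using az by (intro exI[of _ a] exI[of _ b] exI[of _ y]) (simp add: add.assoc)
next
  assume "\<exists>a b y. a > 0 \<and> b > 0 \<and> y \<in> rcone W \<and> x = a *\<^sub>R u + b *\<^sub>R v + y"
  then obtain a b y where *: "a > 0" "b > 0" "y \<in> rcone W" "x = a *\<^sub>R u + (b *\<^sub>R v + y)"
    by (auto simp: add.assoc)
  have "b *\<^sub>R v + y \<in> rcone (insert v W)"
    using rcone_insert[of W v] * assms by auto
  then show "x \<in> rcone (insert u (insert v W))"
    using rcone_insert[of "insert v W" u x] * assms by auto
qed

text \<open>Gives control over generators, which need not lie in the cone themselves: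
  \<open>v\<close> is the difference of the points \<open>x + v\<close> and \<open>x\<close> of the
  cone.\<close>

lemma rcone_add_generator:
  assumes "finite V" "v \<in> V" "x \<in> rcone V" "c \<ge> 0"
  shows "x + c *\<^sub>R v \<in> rcone V"
proof -
  obtain a y where "a > 0" "y \<in> rcone (V - {v})" "x = a *\<^sub>R v + y"
    using rcone_insert[of "V - {v}" v x] assms by (auto simp: insert_absorb)
  then have "x + c *\<^sub>R v = (a + c) *\<^sub>R v + y" "a + c > 0"
    using assms by (auto simp: algebra_simps)
  then show ?thesis
    using rcone_insert[of "V - {v}" v "x + c *\<^sub>R v"] assms \<open>y \<in> _\<close> by (auto simp: insert_absorb)
qed

section \<open>Signs of linear functionals on relatively open cones\<close>

lemma linear_rcone_pos:
  fixes g :: "'v::real_vector \<Rightarrow> real"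
  assumes "linear g" "finite V" "x \<in> rcone V" "\<forall>v\<in>V. g v \<ge> 0" "\<exists>v\<in>V. g v > 0"
  shows "g x > 0"
proof -
  obtain c where c: "\<forall>v\<in>V. c v > 0" "x = (\<Sum>v\<in>V. c v *\<^sub>R v)"
    using assms unfolding rcone_def by blast
  then have "g x = (\<Sum>v\<in>V. c v * g v)"
    using assms by (simp add: linear_sum linear_scale)
  also have "\<dots> > 0"
    using assms c by (intro sum_pos2[of _ "SOME v. v \<in> V \<and> g v > 0"])
      (auto intro: someI2_ex mult_nonneg_nonneg less_imp_le mult_pos_pos)
  finally show ?thesis .
qed

lemma linear_rcone_zero:
  fixes g :: "'v::real_vector \<Rightarrow> real"
  assumes "linear g" "x \<in> rcone V" "\<forall>v\<in>V. g v = 0"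
  shows "g x = 0"
  using assms unfolding rcone_def by (auto simp: linear_sum linear_scale)

lemma linear_rcone_neg:
  fixes g :: "'v::real_vector \<Rightarrow> real"
  assumes "linear g" "finite V" "x \<in> rcone V" "\<forall>v\<in>V. g v \<le> 0" "\<exists>v\<in>V. g v < 0"
  shows "g x < 0"
  using linear_rcone_pos[of "\<lambda>x. - g x" V x] assms by (auto intro: linear_compose_neg)

text \<open>\<open>L\<close> is the set from which generators may be taken, so that integrality or
  positive height survives every subdivision. Cells need not meet face to face; disjointness is what
  lattice point counts and Euler sums rest on.\<close>

definition conic_partition :: "'v::real_vector set \<Rightarrow> 'v set set \<Rightarrow> 'v set \<Rightarrow> bool" where
  "conic_partition L D S \<longleftrightarrow> finite D \<and> (\<forall>V\<in>D. finite V \<and> independent V \<and> V \<subseteq> L) \<and>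
     (\<forall>V\<in>D. \<forall>W\<in>D. V \<noteq> W \<longrightarrow> rcone V \<inter> rcone W = {}) \<and> (\<Union>V\<in>D. rcone V) = S"

lemma conic_partitionD:
  assumes "conic_partition L D S"
  shows "finite D"
    and "V \<in> D \<Longrightarrow> finite V" "V \<in> D \<Longrightarrow> independent V" "V \<in> D \<Longrightarrow> V \<subseteq> L" "V \<in> D \<Longrightarrow> rcone V \<subseteq> S"
    and "V \<in> D \<Longrightarrow> W \<in> D \<Longrightarrow> V \<noteq> W \<Longrightarrow> rcone V \<inter> rcone W = {}"
    and "(\<Union>V\<in>D. rcone V) = S"
  using assms unfolding conic_partition_def by auto

lemma conic_partition_Union:
  assumes D: "conic_partition L D S"
    and E: "\<And>V. V \<in> D \<Longrightarrow> conic_partition L (E V) (rcone V)"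
  shows "conic_partition L (\<Union>V\<in>D. E V) S"
    and "(\<Sum>W\<in>(\<Union>V\<in>D. E V). f W) = (\<Sum>V\<in>D. \<Sum>W\<in>E V. f W)"
proof -
  note D' = conic_partitionD[OF D] and E' = conic_partitionD[OF E]
  have disj: "rcone W \<inter> rcone W' = {}"
    if "V \<in> D" "V' \<in> D" "W \<in> E V" "W' \<in> E V'" "W \<noteq> W'" for V V' W W'
  proof (cases "V = V'")
    case True
    then show ?thesis using E'(6)[of V W W'] that by simp
  next
    case False
    then show ?thesis
      using D'(6)[of V V'] E'(5)[of V W] E'(5)[of V' W'] that by blast
  qed
  show "conic_partition L (\<Union>V\<in>D. E V) S"
    unfolding conic_partition_def
  proof (intro conjI)
    show "finite (\<Union>V\<in>D. E V)" using D'(1) E'(1) by auto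
    show "\<forall>W\<in>(\<Union>V\<in>D. E V). finite W \<and> independent W \<and> W \<subseteq> L"
      using E'(2-4) by fast
    show "\<forall>W\<in>(\<Union>V\<in>D. E V). \<forall>W'\<in>(\<Union>V\<in>D. E V). W \<noteq> W' \<longrightarrow> rcone W \<inter> rcone W' = {}"
      using disj by (metis UN_iff)
    have "(\<Union>W\<in>(\<Union>V\<in>D. E V). rcone W) = (\<Union>V\<in>D. \<Union>W\<in>E V. rcone W)"
      by auto
    also have "\<dots> = S"
      using E'(7) D'(7) by simp
    finally show "(\<Union>W\<in>(\<Union>V\<in>D. E V). rcone W) = S" .
  qed
  \<comment> \<open>A cell shared by two families would lie in two disjoint cones, yet no
    \<open>rcone W\<close> is empty. So no summand is counted twice.\<close>
  have "E V \<inter> E V' = {}" if "V \<in> D" "V' \<in> D" "V \<noteq> V'" for V V'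
  proof (rule ccontr)
    assume "E V \<inter> E V' \<noteq> {}"
    then obtain W where "W \<in> E V" "W \<in> E V'" by blast
    then have "rcone W \<subseteq> rcone V \<inter> rcone V'"
      using E'(5)[of V W] E'(5)[of V' W] that by blast
    then show False using D'(6) that rcone_nonempty[of W] by simp
  qed
  then show "(\<Sum>W\<in>(\<Union>V\<in>D. E V). f W) = (\<Sum>V\<in>D. \<Sum>W\<in>E V. f W)"
    using D'(1) E'(1) by (intro sum.UNION_disjoint) auto
qed

lemma conic_partition_subset:
  assumes "conic_partition L D S" "D' \<subseteq> D"
  shows "conic_partition L D' (\<Union>V\<in>D'. rcone V)"
proof -
  note D = conic_partitionD[OF assms(1)]
  have "finite D'" using D(1) assms(2) finite_subset by blast
  then show ?thesis
    unfolding conic_partition_def using D(2-4,6) assms(2) by (intro conjI ballI impI) (auto simp: subset_iff)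
qed

text \<open>For independent generators each cell is an open ball of dimension \<open>card V\<close>,
  and this is the Euler characteristic with compact support of the union of the cells.\<close>

definition euler_sum :: "'v set set \<Rightarrow> real" where
  "euler_sum D = (\<Sum>V\<in>D. (-1) ^ card V)"

text \<open>Modulo the span of \<open>W\<close> the vectors \<open>u\<close> and \<open>v\<close>
  remain independent, so the coordinates along them are well defined on a cell; comparing these
  coordinates separates the pieces of \<open>stellar_subdivision\<close>.\<close>

lemma independent_pair_coeffs:
  assumes ind: "independent (insert u (insert v W))" and "u \<noteq> v" "u \<notin> W" "v \<notin> W"
    and span: "a *\<^sub>R u + b *\<^sub>R v \<in> span W"
  shows "a = 0 \<and> b = 0"
proof -
  have u: "u \<notin> span (insert v W)" and v: "v \<notin> span W"
    using assms by (auto simp: independent_insert)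
  have scale: "c = 0" if "c *\<^sub>R x \<in> span X" "x \<notin> span X" for c :: real and x and X :: "'a set"
    using span_scale[OF that(1), of "inverse c"] that(2) by (cases "c = 0") auto
  have "b *\<^sub>R v \<in> span (insert v W)" "a *\<^sub>R u + b *\<^sub>R v \<in> span (insert v W)"
    using span span_mono[of W "insert v W"] by (auto intro: span_scale span_base)
  then have "a *\<^sub>R u \<in> span (insert v W)"
    using span_diff by fastforce
  then have "a = 0"
    using u scale by blast
  moreover from this have "b = 0"
    using span v scale by simp
  ultimately show ?thesis by simp
qed

text \<open>For a point \<open>a *\<^sub>R u + b *\<^sub>R v + y\<close> with \<open>y\<close> in
  \<open>rcone W\<close>, the piece on \<open>w\<close> and \<open>W\<close> is where a / \<beta> =
  b / \<alpha>, and the two larger pieces are the two strict inequalities. Two cells with k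
  generators and one with k - 1 replace one with k, so the Euler sum is kept.\<close>

lemma stellar_subdivision:
  assumes fin: "finite W" and ind: "independent (insert u (insert v W))"
    and ne: "u \<noteq> v" "u \<notin> W" "v \<notin> W"
    and pos: "\<alpha> > 0" "\<beta> > 0" and w: "w = \<alpha> *\<^sub>R v + \<beta> *\<^sub>R u"
  shows "w \<notin> insert u (insert v W)"
    and "independent (insert w (insert v W))"
    and "independent (insert w (insert u W))"
    and "rcone (insert u (insert v W)) =
      rcone (insert w (insert v W)) \<union> rcone (insert w (insert u W)) \<union> rcone (insert w W)"
    and "rcone (insert w (insert v W)) \<inter> rcone (insert w (insert u W)) = {}"
    and "rcone (insert w (insert v W)) \<inter> rcone (insert w W) = {}"
    and "rcone (insert w (insert u W)) \<inter> rcone (insert w W) = {}"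
proof -
  have ind': "independent (insert v (insert u W))"
    using ind by (simp add: insert_commute)
  note coeffs = independent_pair_coeffs[OF ind ne]
  have wspan: "w \<notin> span (insert v W)"
  proof
    assume "w \<in> span (insert v W)"
    then obtain k where "w - k *\<^sub>R v \<in> span W" by (auto simp: span_insert)
    then have "\<beta> *\<^sub>R u + (\<alpha> - k) *\<^sub>R v \<in> span W" by (simp add: w algebra_simps)
    then show False using coeffs[of \<beta> "\<alpha> - k"] pos by simp
  qed
  have wspan': "w \<notin> span (insert u W)"
  proof
    assume "w \<in> span (insert u W)"
    then obtain k where "w - k *\<^sub>R u \<in> span W" by (auto simp: span_insert)
    then have "(\<beta> - k) *\<^sub>R u + \<alpha> *\<^sub>R v \<in> span W" by (simp add: w algebra_simps)
    then show False using coeffs[of "\<beta> - k" \<alpha>] pos by simp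
  qed
  show notin: "w \<notin> insert u (insert v W)"
    using wspan wspan' span_superset by blast
  show "independent (insert w (insert v W))"
    using ind wspan by (simp add: independent_insert ne split: if_splits)
  show "independent (insert w (insert u W))"
    using ind' wspan' by (simp add: independent_insert ne split: if_splits)
  have coord: "a *\<^sub>R w + b *\<^sub>R u + c *\<^sub>R v = (a * \<beta> + b) *\<^sub>R u + (a * \<alpha> + c) *\<^sub>R v" for a b c
    by (simp add: w algebra_simps)
  have S1: "x \<in> rcone (insert w (insert v W)) \<longleftrightarrow>
      (\<exists>a b y. a > 0 \<and> b > 0 \<and> y \<in> rcone W \<and> x = (a * \<beta>) *\<^sub>R u + (a * \<alpha> + b) *\<^sub>R v + y)" for x
    using rcone_insert2[of W w v x] coord[of _ 0] notin ne fin by simp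
  have S2: "x \<in> rcone (insert w (insert u W)) \<longleftrightarrow>
      (\<exists>a b y. a > 0 \<and> b > 0 \<and> y \<in> rcone W \<and> x = (a * \<beta> + b) *\<^sub>R u + (a * \<alpha>) *\<^sub>R v + y)" for x
    using rcone_insert2[of W w u x] coord[of _ _ 0] notin ne fin by simp
  have S3: "x \<in> rcone (insert w W) \<longleftrightarrow>
      (\<exists>a y. a > 0 \<and> y \<in> rcone W \<and> x = (a * \<beta>) *\<^sub>R u + (a * \<alpha>) *\<^sub>R v + y)" for x
    using rcone_insert[of W w x] coord[of _ 0 0] notin fin by simp
  note S = rcone_insert2[OF fin ne(2,3,1)]
  have uniq: "a = a' \<and> b = b'"
    if "a *\<^sub>R u + b *\<^sub>R v + y = a' *\<^sub>R u + b' *\<^sub>R v + y'" "y \<in> rcone W" "y' \<in> rcone W" for a b a' b' y y'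
  proof -
    have "(a - a') *\<^sub>R u + (b - b') *\<^sub>R v = y' - y"
      using that(1) by (simp add: algebra_simps)
    moreover have "y' - y \<in> span W"
      using that rcone_subset_span by (intro span_diff) auto
    ultimately have "a - a' = 0 \<and> b - b' = 0" by (intro coeffs) simp
    then show ?thesis by simp
  qed
  show "rcone (insert u (insert v W)) =
      rcone (insert w (insert v W)) \<union> rcone (insert w (insert u W)) \<union> rcone (insert w W)" (is "?L = ?R")
  proof
    show "?L \<subseteq> ?R"
    proof
      fix x assume "x \<in> ?L"
      then obtain a b y where x: "a > 0" "b > 0" "y \<in> rcone W" "x = a *\<^sub>R u + b *\<^sub>R v + y"
        using S by blast
      consider "a / \<beta> < b / \<alpha>" | "a / \<beta> > b / \<alpha>" | "a / \<beta> = b / \<alpha>" by linarith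
      then show "x \<in> ?R"
      proof cases
        case 1
        then have "x \<in> rcone (insert w (insert v W))"
          unfolding S1 using x pos
          by (intro exI[of _ "a / \<beta>"] exI[of _ "b - a / \<beta> * \<alpha>"] exI[of _ y]) (auto simp: field_simps)
        then show ?thesis by blast
      next
        case 2
        then have "x \<in> rcone (insert w (insert u W))"
          unfolding S2 using x pos
          by (intro exI[of _ "b / \<alpha>"] exI[of _ "a - b / \<alpha> * \<beta>"] exI[of _ y]) (auto simp: field_simps)
        then show ?thesis by blast
      next
        case 3
        then have "a / \<beta> > 0" "a / \<beta> * \<beta> = a" "a / \<beta> * \<alpha> = b" using x pos by (auto simp: field_simps)
        then have "x \<in> rcone (insert w W)"
          unfolding S3 using x by metis
        then show ?thesis by blast
      qed
    qed
    have SI: "a *\<^sub>R u + b *\<^sub>R v + y \<in> ?L" if "a > 0" "b > 0" "y \<in> rcone W" for a b y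
      using S that by blast
    show "?R \<subseteq> ?L"
    proof
      fix x assume "x \<in> ?R"
      then consider "x \<in> rcone (insert w (insert v W))" | "x \<in> rcone (insert w (insert u W))" | "x \<in> rcone (insert w W)"
        by blast
      then show "x \<in> ?L"
      proof cases
        case 1
        then show ?thesis using S1[of x] pos by (auto intro!: SI add_pos_pos)
      next
        case 2
        then show ?thesis using S2[of x] pos by (auto intro!: SI add_pos_pos)
      next
        case 3
        then show ?thesis using S3[of x] pos by (auto intro!: SI)
      qed
    qed
  qed
  show "rcone (insert w (insert v W)) \<inter> rcone (insert w (insert u W)) = {}"
  proof (rule Int_emptyI)
    fix x assume x: "x \<in> rcone (insert w (insert v W))" "x \<in> rcone (insert w (insert u W))"
    obtain a b y where 1: "a > 0" "b > 0" "y \<in> rcone W" "x = (a * \<beta>) *\<^sub>R u + (a * \<alpha> + b) *\<^sub>R v + y"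
      using x(1) S1[of x] by blast
    obtain a' b' y' where 2: "a' > 0" "b' > 0" "y' \<in> rcone W" "x = (a' * \<beta> + b') *\<^sub>R u + (a' * \<alpha>) *\<^sub>R v + y'"
      using x(2) S2[of x] by blast
    have "a * \<beta> = a' * \<beta> + b' \<and> a * \<alpha> + b = a' * \<alpha>"
      by (rule uniq[OF _ 1(3) 2(3)]) (use 1(4) 2(4) in simp)
    then have "a * \<beta> > a' * \<beta>" "a * \<alpha> < a' * \<alpha>" using 1(2) 2(2) by auto
    then show False using pos by simp
  qed
  show "rcone (insert w (insert v W)) \<inter> rcone (insert w W) = {}"
  proof (rule Int_emptyI)
    fix x assume x: "x \<in> rcone (insert w (insert v W))" "x \<in> rcone (insert w W)"
    obtain a b y where 1: "a > 0" "b > 0" "y \<in> rcone W" "x = (a * \<beta>) *\<^sub>R u + (a * \<alpha> + b) *\<^sub>R v + y"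
      using x(1) S1[of x] by blast
    obtain a' y' where 2: "a' > 0" "y' \<in> rcone W" "x = (a' * \<beta>) *\<^sub>R u + (a' * \<alpha>) *\<^sub>R v + y'"
      using x(2) S3[of x] by blast
    have "a * \<beta> = a' * \<beta> \<and> a * \<alpha> + b = a' * \<alpha>"
      by (rule uniq[OF _ 1(3) 2(2)]) (use 1(4) 2(3) in simp)
    then show False using pos 1(2) by auto
  qed
  show "rcone (insert w (insert u W)) \<inter> rcone (insert w W) = {}"
  proof (rule Int_emptyI)
    fix x assume x: "x \<in> rcone (insert w (insert u W))" "x \<in> rcone (insert w W)"
    obtain a b y where 1: "a > 0" "b > 0" "y \<in> rcone W" "x = (a * \<beta> + b) *\<^sub>R u + (a * \<alpha>) *\<^sub>R v + y"
      using x(1) S2[of x] by blast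
    obtain a' y' where 2: "a' > 0" "y' \<in> rcone W" "x = (a' * \<beta>) *\<^sub>R u + (a' * \<alpha>) *\<^sub>R v + y'"
      using x(2) S3[of x] by blast
    have "a * \<beta> + b = a' * \<beta> \<and> a * \<alpha> = a' * \<alpha>"
      by (rule uniq[OF _ 1(3) 2(2)]) (use 1(4) 2(3) in simp)
    then show False using pos 1(2) by auto
  qed
qed

section \<open>Cutting cones by a hyperplane\<close>

lemma euler_sum_filter:
  "finite D \<Longrightarrow> euler_sum {W\<in>D. P W} = (\<Sum>W\<in>D. if P W then (-1) ^ card W else 0)"
  unfolding euler_sum_def by (simp add: sum.If_cases Int_def)

text \<open>Coefficients are strictly positive, so when the generators do not straddle the
  hyperplane, a single one off it moves every point of the cell to its side.\<close>

lemma linear_rcone_sign: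
  fixes g :: "'v::real_vector \<Rightarrow> real"
  assumes g: "linear g" and W: "finite W" and x: "x \<in> rcone W"
    and sgn: "(\<forall>w\<in>W. g w \<ge> 0) \<or> (\<forall>w\<in>W. g w \<le> 0)"
  shows "g x > 0 \<longleftrightarrow> (\<exists>w\<in>W. g w > 0)" and "g x = 0 \<longleftrightarrow> (\<forall>w\<in>W. g w = 0)"
proof -
  consider "\<forall>w\<in>W. g w \<ge> 0" "\<exists>w\<in>W. g w > 0" | "\<forall>w\<in>W. g w \<le> 0" "\<exists>w\<in>W. g w < 0" | "\<forall>w\<in>W. g w = 0"
    using sgn by (metis order_le_imp_less_or_eq)
  then have "(g x > 0 \<longleftrightarrow> (\<exists>w\<in>W. g w > 0)) \<and> (g x = 0 \<longleftrightarrow> (\<forall>w\<in>W. g w = 0))"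
  proof cases
    case 1
    then show ?thesis using linear_rcone_pos[OF g W x] by (metis less_irrefl)
  next
    case 2
    then show ?thesis using linear_rcone_neg[OF g W x] by (metis less_irrefl not_le order_less_imp_not_less)
  next
    case 3
    then show ?thesis using linear_rcone_zero[OF g x] by auto
  qed
  then show "g x > 0 \<longleftrightarrow> (\<exists>w\<in>W. g w > 0)" "g x = 0 \<longleftrightarrow> (\<forall>w\<in>W. g w = 0)" by auto
qed

text \<open>Induction on the number of generators off the hyperplane: an edge from a positive to a
  negative generator is split at its point on the hyperplane, and every new cell has lost at least
  one of the two ends. The factor in the last clause is the Euler sum of the slice g = 0 relative to
  that of the cell: the slice is the whole cell, a relatively open cone of one dimension less, or
  empty.\<close>

lemma cut_rcone:
  fixes g :: "'v::real_vector \<Rightarrow> real"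
  assumes g: "linear g"
    and L: "\<And>u v. u \<in> L \<Longrightarrow> v \<in> L \<Longrightarrow> g u > 0 \<Longrightarrow> g v < 0 \<Longrightarrow> g u *\<^sub>R v - g v *\<^sub>R u \<in> L"
    and "finite V" "independent V" "V \<subseteq> L"
  shows "\<exists>D. conic_partition L D (rcone V) \<and>
    (\<forall>W\<in>D. (\<forall>w\<in>W. g w \<ge> 0) \<or> (\<forall>w\<in>W. g w \<le> 0)) \<and>
    euler_sum {W\<in>D. \<forall>w\<in>W. g w = 0} = (-1) ^ card V *
      (if \<forall>v\<in>V. g v = 0 then 1 else if (\<exists>v\<in>V. g v > 0) \<and> (\<exists>v\<in>V. g v < 0) then -1 else 0)"
  using assms(3-5)
proof (induction "card {v\<in>V. g v \<noteq> 0}" arbitrary: V rule: less_induct)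
  case (less V)
  show ?case
  proof (cases "(\<exists>v\<in>V. g v > 0) \<and> (\<exists>v\<in>V. g v < 0)")
    case False
    have "conic_partition L {V} (rcone V)"
      using less.prems by (simp add: conic_partition_def)
    moreover have "{W\<in>{V}. \<forall>w\<in>W. g w = 0} = (if \<forall>v\<in>V. g v = 0 then {V} else {})"
      by auto
    ultimately show ?thesis
      using False by (intro exI[of _ "{V}"]) (auto simp: euler_sum_def not_less)
  next
    case True
    then obtain u v where uv: "u \<in> V" "v \<in> V" "g u > 0" "g v < 0" by blast
    define W where "W = V - {u, v}"
    define w where "w = g u *\<^sub>R v - g v *\<^sub>R u"
    have V: "V = insert u (insert v W)" using uv by (auto simp: W_def)
    have W: "finite W" "u \<notin> W" "v \<notin> W" "u \<noteq> v" using less.prems uv by (auto simp: W_def)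
    have w': "w = g u *\<^sub>R v + (- g v) *\<^sub>R u" by (simp add: w_def)
    have gw: "g w = 0" using g by (simp add: w_def linear_diff linear_scale)
    have "w \<in> L" using L less.prems uv unfolding w_def by blast
    note st = stellar_subdivision[OF W(1) less.prems(2)[unfolded V] W(4,2,3) _ _ w']
    have st0: "w \<notin> insert u (insert v W)"
      and ind1: "independent (insert w (insert v W))"
      and ind2: "independent (insert w (insert u W))"
      and split: "rcone V = rcone (insert w (insert v W)) \<union> rcone (insert w (insert u W)) \<union> rcone (insert w W)"
      and disj: "rcone (insert w (insert v W)) \<inter> rcone (insert w (insert u W)) = {}"
        "rcone (insert w (insert v W)) \<inter> rcone (insert w W) = {}"
        "rcone (insert w (insert u W)) \<inter> rcone (insert w W) = {}"
      using st uv unfolding V by auto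
    have ind3: "independent (insert w W)" using ind1 by (rule independent_mono) auto
    let ?V1 = "insert w (insert v W)" and ?V2 = "insert w (insert u W)" and ?V3 = "insert w W"
    let ?z = "\<lambda>V. if \<forall>v\<in>V. g v = 0 then 1 else if (\<exists>v\<in>V. g v > 0) \<and> (\<exists>v\<in>V. g v < 0) then -1 else 0 :: real"
    let ?goal = "\<lambda>V D. conic_partition L D (rcone V) \<and>
      (\<forall>W\<in>D. (\<forall>w\<in>W. g w \<ge> 0) \<or> (\<forall>w\<in>W. g w \<le> 0)) \<and>
      euler_sum {W\<in>D. \<forall>w\<in>W. g w = 0} = (-1) ^ card V * ?z V"
    have lessV: "card {x\<in>V'. g x \<noteq> 0} < card {x\<in>V. g x \<noteq> 0}"
      if "V' \<in> {?V1, ?V2, ?V3}" for V'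
    proof (rule psubset_card_mono)
      show "finite {x\<in>V. g x \<noteq> 0}" using less.prems by simp
      show "{x\<in>V'. g x \<noteq> 0} \<subset> {x\<in>V. g x \<noteq> 0}"
      proof (rule psubsetI)
        show "{x\<in>V'. g x \<noteq> 0} \<subseteq> {x\<in>V. g x \<noteq> 0}"
          using that gw unfolding V by fastforce
        have "u \<notin> V' \<or> v \<notin> V'" using that W st0 by fast
        moreover have "u \<in> {x\<in>V. g x \<noteq> 0}" "v \<in> {x\<in>V. g x \<noteq> 0}" using uv by auto
        ultimately show "{x\<in>V'. g x \<noteq> 0} \<noteq> {x\<in>V. g x \<noteq> 0}" by blast
      qed
    qed
    have f: "finite ?V1" "?V1 \<subseteq> L" "finite ?V2" "?V2 \<subseteq> L" "finite ?V3" "?V3 \<subseteq> L"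
      using \<open>w \<in> L\<close> W(1) less.prems(3) unfolding V by auto
    have "\<exists>D. ?goal ?V1 D" by (rule less.hyps[OF lessV f(1) ind1 f(2)]) simp
    then obtain D1 where D1: "?goal ?V1 D1" by (rule exE)
    have "\<exists>D. ?goal ?V2 D" by (rule less.hyps[OF lessV f(3) ind2 f(4)]) simp
    then obtain D2 where D2: "?goal ?V2 D2" by (rule exE)
    have "\<exists>D. ?goal ?V3 D" by (rule less.hyps[OF lessV f(5) ind3 f(6)]) simp
    then obtain D3 where D3: "?goal ?V3 D3" by (rule exE)
    define E where "E X = (if X = ?V1 then D1 else if X = ?V2 then D2 else D3)" for X
    have distinct: "?V1 \<noteq> ?V2" "?V1 \<noteq> ?V3" "?V2 \<noteq> ?V3" using st0 W by auto
    then have EV: "E ?V1 = D1" "E ?V2 = D2" "E ?V3 = D3" by (auto simp: E_def)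
    have part0: "conic_partition L {?V1, ?V2, ?V3} (rcone V)"
      unfolding conic_partition_def using f ind1 ind2 ind3 split disj
      by (intro conjI ballI impI) (auto simp: Int_commute)
    have EP: "conic_partition L (E X) (rcone X)" if "X \<in> {?V1, ?V2, ?V3}" for X
      using that EV D1 D2 D3 by auto
    note un = conic_partition_Union[OF part0 EP]
    have UN: "(\<Union>X\<in>{?V1, ?V2, ?V3}. E X) = D1 \<union> D2 \<union> D3"
      using EV by auto
    have sumeq: "euler_sum {W \<in> D1 \<union> D2 \<union> D3. \<forall>w\<in>W. g w = 0} =
        euler_sum {W\<in>D1. \<forall>w\<in>W. g w = 0} + euler_sum {W\<in>D2. \<forall>w\<in>W. g w = 0} + euler_sum {W\<in>D3. \<forall>w\<in>W. g w = 0}"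
    proof -
      have fin: "finite D1" "finite D2" "finite D3" "finite (D1 \<union> D2 \<union> D3)"
        using D1 D2 D3 unfolding conic_partition_def by auto
      have "(\<Sum>W\<in>D1 \<union> D2 \<union> D3. if \<forall>w\<in>W. g w = 0 then (-1) ^ card W else 0) =
          (\<Sum>X\<in>{?V1, ?V2, ?V3}. \<Sum>W\<in>E X. if \<forall>w\<in>W. g w = 0 then (-1) ^ card W else 0 :: real)"
        unfolding UN[symmetric] by (rule un(2))
      then show ?thesis
        unfolding euler_sum_filter[OF fin(1)] euler_sum_filter[OF fin(2)]
          euler_sum_filter[OF fin(3)] euler_sum_filter[OF fin(4)]
        using distinct by (simp add: EV)
    qed
    have cards: "card ?V1 = Suc (Suc (card W))" "card ?V2 = Suc (Suc (card W))" "card ?V3 = Suc (card W)"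
      "card V = Suc (Suc (card W))"
      using W st0 unfolding V by auto
    have z: "?z V = -1" "?z ?V1 = (if \<exists>v\<in>W. g v > 0 then -1 else 0)"
      "?z ?V2 = (if \<exists>v\<in>W. g v < 0 then -1 else 0)"
      using uv gw unfolding V by auto
    have z3: "?z ?V3 = (if (\<exists>v\<in>W. g v > 0) \<and> (\<exists>v\<in>W. g v < 0) then -1
        else if (\<exists>v\<in>W. g v > 0) \<or> (\<exists>v\<in>W. g v < 0) then 0 else 1)"
      using gw by (auto, metis not_less_iff_gr_or_eq)
    \<comment> \<open>Relative to \<open>(-1) ^ card V\<close> the pieces contribute
      \<open>?z ?V1 + ?z ?V2 - ?z ?V3\<close>, the minus coming from the missing generator. With
      both signs in \<open>W\<close> this is -1 - 1 + 1, with one sign -1 + 0 - 0, with none 0 + 0 -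
      1: always \<open>?z V\<close>.\<close>
    have "euler_sum {W \<in> D1 \<union> D2 \<union> D3. \<forall>w\<in>W. g w = 0} = (-1) ^ card V * ?z V"
      using D1 D2 D3 unfolding sumeq z z3 cards by auto
    then show ?thesis
      using un(1) D1 D2 D3 unfolding UN by (intro exI[of _ "D1 \<union> D2 \<union> D3"]) auto
  qed
qed

text \<open>The factor of \<open>cut_rcone\<close>: the Euler sum of a slice in units of that of its
  cell.\<close>

definition cut_weight :: "('v \<Rightarrow> real) \<Rightarrow> 'v set \<Rightarrow> real" where
  "cut_weight g V = (if \<forall>v\<in>V. g v = 0 then 1 else if (\<exists>v\<in>V. g v > 0) \<and> (\<exists>v\<in>V. g v < 0) then -1 else 0)"

text \<open>Stability of \<open>L\<close> under the only new generators that a cut by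
  \<open>g\<close> creates.\<close>

definition cut_closed :: "('v::real_vector \<Rightarrow> real) \<Rightarrow> 'v set \<Rightarrow> bool" where
  "cut_closed g L \<longleftrightarrow> (\<forall>u\<in>L. \<forall>v\<in>L. g u > 0 \<longrightarrow> g v < 0 \<longrightarrow> g u *\<^sub>R v - g v *\<^sub>R u \<in> L)"

lemma cut_conic_partition:
  fixes g :: "'v::real_vector \<Rightarrow> real"
  assumes g: "linear g" and L: "cut_closed g L" and D: "conic_partition L D S"
  obtains E where "conic_partition L E S"
    and "\<forall>W\<in>E. (\<forall>w\<in>W. g w \<ge> 0) \<or> (\<forall>w\<in>W. g w \<le> 0)"
    and "euler_sum {W\<in>E. \<forall>w\<in>W. g w = 0} = (\<Sum>V\<in>D. (-1) ^ card V * cut_weight g V)"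
proof -
  note D' = conic_partitionD[OF D]
  have "\<forall>V\<in>D. \<exists>E. conic_partition L E (rcone V) \<and>
      (\<forall>W\<in>E. (\<forall>w\<in>W. g w \<ge> 0) \<or> (\<forall>w\<in>W. g w \<le> 0)) \<and>
      euler_sum {W\<in>E. \<forall>w\<in>W. g w = 0} = (-1) ^ card V * cut_weight g V"
  proof
    fix V assume "V \<in> D"
    then show "\<exists>E. conic_partition L E (rcone V) \<and>
        (\<forall>W\<in>E. (\<forall>w\<in>W. g w \<ge> 0) \<or> (\<forall>w\<in>W. g w \<le> 0)) \<and>
        euler_sum {W\<in>E. \<forall>w\<in>W. g w = 0} = (-1) ^ card V * cut_weight g V"
      unfolding cut_weight_def using L[unfolded cut_closed_def]
      by (intro cut_rcone[OF g _ D'(2-4)]) blast+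
  qed
  from bchoice[OF this] obtain E where E': "\<forall>V\<in>D. conic_partition L (E V) (rcone V) \<and>
      (\<forall>W\<in>E V. (\<forall>w\<in>W. g w \<ge> 0) \<or> (\<forall>w\<in>W. g w \<le> 0)) \<and>
      euler_sum {W\<in>E V. \<forall>w\<in>W. g w = 0} = (-1) ^ card V * cut_weight g V" ..
  then have E: "\<And>V. V \<in> D \<Longrightarrow> conic_partition L (E V) (rcone V)"
    and sgn: "\<And>V W. V \<in> D \<Longrightarrow> W \<in> E V \<Longrightarrow> (\<forall>w\<in>W. g w \<ge> 0) \<or> (\<forall>w\<in>W. g w \<le> 0)"
    and eul: "\<And>V. V \<in> D \<Longrightarrow> euler_sum {W\<in>E V. \<forall>w\<in>W. g w = 0} = (-1) ^ card V * cut_weight g V"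
    by simp_all
  note un = conic_partition_Union[OF D E]
  have "euler_sum {W\<in>(\<Union>V\<in>D. E V). \<forall>w\<in>W. g w = 0} =
      (\<Sum>W\<in>(\<Union>V\<in>D. E V). if \<forall>w\<in>W. g w = 0 then (-1) ^ card W else 0)"
    by (rule euler_sum_filter[OF conic_partitionD(1)[OF un(1)]])
  also have "\<dots> = (\<Sum>V\<in>D. \<Sum>W\<in>E V. if \<forall>w\<in>W. g w = 0 then (-1) ^ card W else 0)"
    by (rule un(2))
  also have "\<dots> = (\<Sum>V\<in>D. (-1) ^ card V * cut_weight g V)"
  proof (rule sum.cong[OF refl])
    fix V assume V: "V \<in> D"
    show "(\<Sum>W\<in>E V. if \<forall>w\<in>W. g w = 0 then (-1) ^ card W else 0) = (-1) ^ card V * cut_weight g V"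
      using eul[OF V] unfolding euler_sum_filter[OF conic_partitionD(1)[OF E[OF V]]] .
  qed
  finally have "euler_sum {W\<in>(\<Union>V\<in>D. E V). \<forall>w\<in>W. g w = 0} = (\<Sum>V\<in>D. (-1) ^ card V * cut_weight g V)" .
  moreover have "(\<forall>w\<in>W. g w \<ge> 0) \<or> (\<forall>w\<in>W. g w \<le> 0)" if "W \<in> (\<Union>V\<in>D. E V)" for W
    using that sgn by blast
  then have "\<forall>W\<in>(\<Union>V\<in>D. E V). (\<forall>w\<in>W. g w \<ge> 0) \<or> (\<forall>w\<in>W. g w \<le> 0)"
    by blast
  ultimately show ?thesis
    by (intro that[OF un(1)])
qed

text \<open>Once no cell straddles the hyperplane, each lies in it or misses it, so the cells with
  all generators on it partition the slice.\<close>

lemma conic_partition_slice: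
  fixes g :: "'v::real_vector \<Rightarrow> real"
  assumes g: "linear g" and L: "cut_closed g L" and D: "conic_partition L D S"
  obtains E where "conic_partition L E {x\<in>S. g x = 0}"
    and "euler_sum E = (\<Sum>V\<in>D. (-1) ^ card V * cut_weight g V)"
proof -
  obtain E where E: "conic_partition L E S"
    and sgn: "\<forall>W\<in>E. (\<forall>w\<in>W. g w \<ge> 0) \<or> (\<forall>w\<in>W. g w \<le> 0)"
    and eul: "euler_sum {W\<in>E. \<forall>w\<in>W. g w = 0} = (\<Sum>V\<in>D. (-1) ^ card V * cut_weight g V)"
    by (rule cut_conic_partition[OF g L D])
  note zero = linear_rcone_sign(2)[OF g conic_partitionD(2)[OF E] _ bspec[OF sgn]]
  have "(\<Union>W\<in>{W\<in>E. \<forall>w\<in>W. g w = 0}. rcone W) = {x\<in>S. g x = 0}"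
    unfolding conic_partitionD(7)[OF E, symmetric] using zero by fast
  moreover have "conic_partition L {W\<in>E. \<forall>w\<in>W. g w = 0} (\<Union>W\<in>{W\<in>E. \<forall>w\<in>W. g w = 0}. rcone W)"
    by (rule conic_partition_subset[OF E]) auto
  ultimately show ?thesis
    using that eul by simp
qed

text \<open>After each cut a cell with a positive generator lies wholly in the open half-space, and
  the other cells miss it; dropping those leaves a partition.\<close>

lemma conic_partition_halfspaces:
  fixes H :: "('v::real_vector \<Rightarrow> real) set"
  assumes "finite H" and D: "conic_partition L D S"
    and H: "\<And>g. g \<in> H \<Longrightarrow> linear g \<and> cut_closed g L"
  shows "\<exists>E. conic_partition L E {x\<in>S. \<forall>g\<in>H. g x > 0}"
  using \<open>finite H\<close> H
proof (induction H)
  case empty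
  then show ?case using D by auto
next
  case (insert g H)
  then obtain D where D: "conic_partition L D {x\<in>S. \<forall>g\<in>H. g x > 0}" by auto
  have g: "linear g" "cut_closed g L" using insert.prems by auto
  obtain E where E: "conic_partition L E {x\<in>S. \<forall>g\<in>H. g x > 0}"
    and sgn: "\<forall>W\<in>E. (\<forall>w\<in>W. g w \<ge> 0) \<or> (\<forall>w\<in>W. g w \<le> 0)"
    and "euler_sum {W\<in>E. \<forall>w\<in>W. g w = 0} = (\<Sum>V\<in>D. (-1) ^ card V * cut_weight g V)"
    by (rule cut_conic_partition[OF g D])
  note pos = linear_rcone_sign(1)[OF g(1) conic_partitionD(2)[OF E] _ bspec[OF sgn]]
  have "(\<Union>W\<in>{W\<in>E. \<exists>w\<in>W. g w > 0}. rcone W) = {x\<in>{x\<in>S. \<forall>g\<in>H. g x > 0}. g x > 0}"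
    unfolding conic_partitionD(7)[OF E, symmetric] using pos by fast
  also have "\<dots> = {x\<in>S. \<forall>g\<in>insert g H. g x > 0}"
    by auto
  finally show ?case
    using conic_partition_subset[OF E, of "{W\<in>E. \<exists>w\<in>W. g w > 0}"] by auto
qed

section \<open>The Euler characteristic of an open cone\<close>

text \<open>A step \<epsilon> so small that c + \<epsilon> stands for the right-hand limit at c, for
  every step function with jumps in \<open>C\<close>.\<close>

lemma finite_real_gap:
  fixes C :: "real set"
  assumes "finite C"
  obtains \<epsilon> where "\<epsilon> > 0" "\<And>c c'. c \<in> C \<Longrightarrow> c' \<in> C \<Longrightarrow> c < c' \<Longrightarrow> c + \<epsilon> < c'"
proof -
  define \<Delta> where "\<Delta> = insert 1 ((\<lambda>(c, c'). c' - c) ` {(c, c') \<in> C \<times> C. c < c'})"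
  have fin: "finite \<Delta>"
    unfolding \<Delta>_def
    by (rule finite.insertI, rule finite_imageI, rule finite_subset[of _ "C \<times> C"]) (use assms in auto)
  have pos: "\<forall>d\<in>\<Delta>. d > 0" by (auto simp: \<Delta>_def)
  have "\<Delta> \<noteq> {}" by (simp add: \<Delta>_def)
  then have "Min \<Delta> > 0" using fin pos by auto
  moreover have "c + Min \<Delta> / 2 < c'" if "c \<in> C" "c' \<in> C" "c < c'" for c c'
  proof -
    have "c' - c \<in> \<Delta>" using that by (auto simp: \<Delta>_def)
    then have "Min \<Delta> \<le> c' - c" using fin by simp
    then show ?thesis using \<open>Min \<Delta> > 0\<close> by linarith
  qed
  ultimately show ?thesis using that[of "Min \<Delta> / 2"] by simp
qed

text \<open>For a cone whose generators have slopes from \<open>p\<close> to \<open>q\<close>, the Euler sum of the slice at slope \<open>k\<close>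
  relative to that of the cone.\<close>

definition cut_profile :: "real \<Rightarrow> real \<Rightarrow> real \<Rightarrow> real" where
  "cut_profile p q k = (if p = k \<and> q = k then 1 else if p < k \<and> k < q then -1 else 0)"

text \<open>The Euler integral of a profile, written as the sum of the differences between values
  and right-hand limits. The only such drop is at \<open>p\<close>, from 1 to 0 if
  \<open>p = q\<close> and from 0 to -1 otherwise; the rise at \<open>q\<close> lies between the
  left-hand limit and the value.\<close>

lemma cut_profile_jump_sum:
  assumes "finite C" "p \<in> C" "q \<in> C" "p \<le> q" "\<epsilon> > 0"
    and gap: "\<And>c c'. c \<in> C \<Longrightarrow> c' \<in> C \<Longrightarrow> c < c' \<Longrightarrow> c + \<epsilon> < c'"
  shows "(\<Sum>c\<in>C. cut_profile p q c - cut_profile p q (c + \<epsilon>)) = 1"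
proof -
  have "cut_profile p q c - cut_profile p q (c + \<epsilon>) = (if c = p then 1 else 0)" if c: "c \<in> C" for c
  proof -
    have "c < p \<Longrightarrow> c + \<epsilon> < p" "c < q \<Longrightarrow> c + \<epsilon> < q" using gap c assms by auto
    moreover have "c < p \<or> c = p \<or> c > p" "c < q \<or> c = q \<or> c > q" by auto
    ultimately show ?thesis using assms(4,5) unfolding cut_profile_def by (auto split: if_splits)
  qed
  then have "(\<Sum>c\<in>C. cut_profile p q c - cut_profile p q (c + \<epsilon>)) = (\<Sum>c\<in>C. if c = p then 1 else 0)"
    by (intro sum.cong) auto
  then show ?thesis using assms by simp
qed

text \<open>The cone over the configurations of \<open>q\<close> pieces lives in dimension
  \<open>2 * q + 1\<close>, which varies with \<open>q\<close>; vectors are therefore real functions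
  on an index type, supported on a finite set of coordinates.\<close>

instantiation "fun" :: (type, real_vector) real_vector
begin

definition scaleR_fun :: "real \<Rightarrow> ('a \<Rightarrow> 'b) \<Rightarrow> 'a \<Rightarrow> 'b" where
  "scaleR_fun c f = (\<lambda>x. c *\<^sub>R f x)"

instance
  by standard (auto simp: scaleR_fun_def fun_eq_iff algebra_simps)

end

lemma scaleR_fun_apply [simp]: "(c *\<^sub>R f) x = c *\<^sub>R f x"
  by (simp add: scaleR_fun_def)

lemma sum_fun_apply: "(\<Sum>a\<in>A. f a) x = (\<Sum>a\<in>A. f a x)"
  for f :: "'a \<Rightarrow> 'b \<Rightarrow> 'c::comm_monoid_add"
  by (induction A rule: infinite_finite_induct) auto

text \<open>\<open>h\<close> is the coordinate of the height. Coordinates in \<open>J\<close> have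
  their slope prescribed, so for \<open>J \<subseteq> I\<close> and \<open>h\<close> outside the
  finite set \<open>I\<close> the dimension is \<open>card (I - J) + 1\<close>.\<close>

definition slice_space :: "'i \<Rightarrow> 'i set \<Rightarrow> 'i set \<Rightarrow> ('i \<Rightarrow> real) \<Rightarrow> ('i \<Rightarrow> real) set" where
  "slice_space h I J c = {x. (\<forall>i. i \<notin> insert h I \<longrightarrow> x i = 0) \<and> (\<forall>j\<in>J. x j = c j * x h)}"

lemma linear_ratio: "linear (\<lambda>x :: 'i \<Rightarrow> real. x i - k * x j)"
  by (intro linearI) (auto simp: algebra_simps)

lemma cut_closed_height: "cut_closed g {x :: 'i \<Rightarrow> real. x h > 0}"
  unfolding cut_closed_def
proof (intro ballI impI)
  fix u v :: "'i \<Rightarrow> real"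
  assume "u \<in> {x. x h > 0}" "v \<in> {x. x h > 0}" "g u > 0" "g v < 0"
  then have "g u * v h > 0" "g v * u h < 0" by (auto intro: mult_neg_pos)
  then show "g u *\<^sub>R v - g v *\<^sub>R u \<in> {x. x h > 0}" by simp
qed

text \<open>Heights are positive, so the sign of \<open>v i - k * v h\<close> is that of the slope
  minus \<open>k\<close>, and only the extreme slopes matter.\<close>

lemma cut_weight_profile:
  assumes "finite V" "V \<noteq> {}" "\<forall>v\<in>V. v h > 0"
  shows "cut_weight (\<lambda>x. x i - k * x h) V =
    cut_profile (Min ((\<lambda>v. v i / v h) ` V)) (Max ((\<lambda>v. v i / v h) ` V)) k"
proof -
  let ?R = "(\<lambda>v. v i / v h) ` V"
  have R: "finite ?R" "?R \<noteq> {}" using assms by auto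
  have *: "v i - k * v h = 0 \<longleftrightarrow> v i / v h = k" "v i - k * v h > 0 \<longleftrightarrow> v i / v h > k"
      "v i - k * v h < 0 \<longleftrightarrow> v i / v h < k" if "v \<in> V" for v
    using assms(3) that by (auto simp: field_simps)
  have all: "(\<forall>v\<in>V. v i - k * v h = 0) \<longleftrightarrow> Min ?R = k \<and> Max ?R = k"
  proof
    assume "\<forall>v\<in>V. v i - k * v h = 0"
    then have "?R = {k}" using * assms(2) by auto
    then show "Min ?R = k \<and> Max ?R = k" by simp
  next
    assume "Min ?R = k \<and> Max ?R = k"
    then have "r = k" if "r \<in> ?R" for r
      using that Min_le[OF R(1) that] Max_ge[OF R(1) that] by simp
    then show "\<forall>v\<in>V. v i - k * v h = 0" using * by blast
  qed
  have "(\<exists>v\<in>V. v i - k * v h > 0) \<longleftrightarrow> (\<exists>r\<in>?R. r > k)" using * by blast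
  then have ex1: "(\<exists>v\<in>V. v i - k * v h > 0) \<longleftrightarrow> k < Max ?R"
    using R by (simp add: Max_gr_iff del: bex_simps)
  have "(\<exists>v\<in>V. v i - k * v h < 0) \<longleftrightarrow> (\<exists>r\<in>?R. r < k)" using * by blast
  then have ex2: "(\<exists>v\<in>V. v i - k * v h < 0) \<longleftrightarrow> Min ?R < k"
    using R by (simp add: Min_less_iff del: bex_simps)
  show ?thesis
    unfolding cut_weight_def cut_profile_def all ex1 ex2 by simp
qed


text \<open>The base of the induction on dimension. All generators lie on one ray, so independence
  leaves one per cell; then every cell is the whole ray, and disjointness leaves one cell.\<close>

lemma euler_sum_ray:
  fixes e :: "'v::real_vector"
  assumes D: "conic_partition L D F" and "F \<noteq> {}" "0 \<notin> F"
    and line: "\<And>V v. V \<in> D \<Longrightarrow> v \<in> V \<Longrightarrow> \<exists>a>0. v = a *\<^sub>R e"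
  shows "euler_sum D = -1"
proof -
  note D' = conic_partitionD[OF D]
  have cell: "card V = 1 \<and> e \<in> rcone V" if V: "V \<in> D" for V
  proof -
    have "V \<noteq> {}" using D'(5)[OF V] \<open>0 \<notin> F\<close> by auto
    then obtain v where v: "v \<in> V" by blast
    obtain a where a: "a > 0" "v = a *\<^sub>R e" using line[OF V v] by blast
    have "w = v" if w: "w \<in> V" for w
    proof (rule ccontr)
      assume "w \<noteq> v"
      obtain b where b: "b > 0" "w = b *\<^sub>R e" using line[OF V w] by blast
      have "w = (b / a) *\<^sub>R v" using a b by simp
      moreover have "v \<in> V - {w}" using v \<open>w \<noteq> v\<close> by simp
      ultimately have "w \<in> span (V - {w})" by (metis span_base span_scale)
      then show False using D'(3)[OF V] w by (auto simp: dependent_def)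
    qed
    then have "V = {v}" using v by blast
    moreover have "e \<in> rcone {v}"
      using rcone_insert[of "{}" v e] a by (auto intro!: exI[of _ "1 / a"])
    ultimately show ?thesis by simp
  qed
  obtain V where V: "V \<in> D" using D'(7) \<open>F \<noteq> {}\<close> by blast
  have "W = V" if "W \<in> D" for W
    using D'(6)[OF that V] cell[OF V] cell[OF that] by blast
  then have "D = {V}" using V by blast
  then show ?thesis using cell[OF V] by (simp add: euler_sum_def)
qed

text \<open>Applied to the set of slopes of an open convex cone, where \<open>op\<close> and
  \<open>between\<close> are openness and convexity.\<close>

lemma open_convex_real_interval:
  fixes A :: "real set"
  assumes "A \<noteq> {}" and bdd: "\<And>k. k \<in> A \<Longrightarrow> l \<le> k \<and> k \<le> u"
    and between: "\<And>j k m. j \<in> A \<Longrightarrow> m \<in> A \<Longrightarrow> j < k \<Longrightarrow> k < m \<Longrightarrow> k \<in> A"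
    and op: "\<And>k. k \<in> A \<Longrightarrow> \<exists>\<epsilon>>0. \<forall>s. \<bar>s\<bar> < \<epsilon> \<longrightarrow> k + s \<in> A"
  obtains a b where "a < b" "A = {a<..<b}"
proof -
  have bd: "bdd_below A" "bdd_above A" using bdd by (auto simp: bdd_below_def bdd_above_def)
  have in1: "Inf A < k \<and> k < Sup A" if k: "k \<in> A" for k
  proof -
    obtain \<epsilon> where "\<epsilon> > 0" "\<forall>s. \<bar>s\<bar> < \<epsilon> \<longrightarrow> k + s \<in> A" using op[OF k] by blast
    then have "k + \<epsilon> / 2 \<in> A" "k + - \<epsilon> / 2 \<in> A" by (auto simp del: add_uminus_conv_diff)
    then have "k + \<epsilon> / 2 \<le> Sup A" "Inf A \<le> k + - \<epsilon> / 2"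
      using bd by (auto intro: cSup_upper cInf_lower simp del: add_uminus_conv_diff)
    then show ?thesis using \<open>\<epsilon> > 0\<close> by auto
  qed
  have in2: "k \<in> A" if "Inf A < k" "k < Sup A" for k
    using that between cInf_less_iff[OF assms(1) bd(1)] less_cSup_iff[OF assms(1) bd(2)] by blast
  have "A = {Inf A<..<Sup A}" using in1 in2 by auto
  moreover have "Inf A < Sup A" using in1 assms(1) by force
  ultimately show ?thesis using that by blast
qed

text \<open>
  Slicing at \<open>x i = k * x h\<close> turns the cell \<open>V\<close> into cells with total weight \<open>(-1) ^ card V\<close> times
  the profile of the interval of slopes of \<open>V\<close>. By induction the sum of all these is a multiple of the
  profile of the interval of slopes of \<open>F\<close>, and the sum of the jumps \<open>f c - f (c + \<epsilon>)\<close> is \<open>1\<close> for every profile \<open>f\<close>.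
\<close>

lemma euler_sum_rel_open:
  fixes F :: "('i \<Rightarrow> real) set"
  assumes "finite I" "h \<notin> I" "J \<subseteq> I"
    and "conic_partition {x. x h > 0} D F"
    and "F \<subseteq> slice_space h I J c" "F \<noteq> {}" "\<And>x. x \<in> F \<Longrightarrow> x h > 0"
    and "\<And>x y a b. x \<in> F \<Longrightarrow> y \<in> F \<Longrightarrow> a > 0 \<Longrightarrow> b > 0 \<Longrightarrow> a *\<^sub>R x + b *\<^sub>R y \<in> F"
    and "\<And>x u. x \<in> F \<Longrightarrow> u \<in> slice_space h I J c \<Longrightarrow> \<exists>\<epsilon>>0. \<forall>s. \<bar>s\<bar> < \<epsilon> \<longrightarrow> x + s *\<^sub>R u \<in> F"
  shows "euler_sum D = - ((-1) ^ card (I - J))"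
  using assms(3-)
proof (induction "card (I - J)" arbitrary: J c D F)
  case 0
  then have "J = I" using assms(1) by auto
  note D = conic_partitionD[OF 0(3)]
  define e where "e = (\<lambda>i. if i = h then 1 else if i \<in> I then c i else 0)"
  have "euler_sum D = -1"
  proof (rule euler_sum_ray[OF 0(3) \<open>F \<noteq> {}\<close>, of e])
    show "0 \<notin> F" using 0(6) by force
    fix V v assume V: "V \<in> D" and v: "v \<in> V"
    obtain s where s: "s \<in> rcone V" using rcone_nonempty by blast
    \<comment> \<open>As the difference of the points s + v and s of its cell, the generator obeys
      the linear equations of the slice.\<close>
    then have "s + 1 *\<^sub>R v \<in> rcone V" using D(2)[OF V] v by (intro rcone_add_generator) auto
    with s have "s \<in> slice_space h I I c" "s + v \<in> slice_space h I I c"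
      using D(5)[OF V] 0(4) \<open>J = I\<close> by auto
    then have "v i = (v h *\<^sub>R e) i" for i
      using assms(2) by (auto simp: slice_space_def e_def algebra_simps)
    then show "\<exists>a>0. v = a *\<^sub>R e"
      using D(4)[OF V] v by blast
  qed
  then show ?case using \<open>J = I\<close> by simp
next
  case (Suc n)
  note part = Suc.prems(2) and sub = Suc.prems(3) and ne = Suc.prems(4) and height = Suc.prems(5)
    and conv = Suc.prems(6) and op = Suc.prems(7)
  note D = conic_partitionD[OF part]
  have "I - J \<noteq> {}" using Suc.hyps(2) by force
  then obtain i where i: "i \<in> I" "i \<notin> J" by blast
  then have "i \<noteq> h" using assms(2) by auto
  have "I - J = insert i (I - insert i J)" using i by auto
  then have "card (I - J) = Suc (card (I - insert i J))"
    using assms(1) by (metis card_insert_disjoint finite_Diff DiffD2 insertI1)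
  then have card: "n = card (I - insert i J)" "card (I - J) = Suc (card (I - insert i J))"
    using Suc.hyps(2) by linarith+
  define e' :: real where "e' = - ((-1) ^ card (I - insert i J))"
  define g where "g k = (\<lambda>x :: 'i \<Rightarrow> real. x i - k * x h)" for k
  define A where "A = {k. \<exists>x\<in>F. g k x = 0}"
  define \<rho> where "\<rho> v = v i / v h" for v :: "'i \<Rightarrow> real"
  have lin: "linear (g k)" for k unfolding g_def by (rule linear_ratio)
  have heightV: "v h > 0" if "V \<in> D" "v \<in> V" for V v using D(4) that by blast
  have neV: "V \<noteq> {}" if "V \<in> D" for V
    using D(5)[OF that] height[of 0] by auto
  have slice: "(\<Sum>V\<in>D. (-1) ^ card V * cut_weight (g k) V) = (if k \<in> A then e' else 0)" for k
  proof -
    obtain E where E: "conic_partition {x. x h > 0} E {x\<in>F. g k x = 0}"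
      "euler_sum E = (\<Sum>V\<in>D. (-1) ^ card V * cut_weight (g k) V)"
      by (rule conic_partition_slice[OF lin cut_closed_height part])
    \<comment> \<open>Slicing prescribes one more slope, so the slice is a cone of the same kind
      with \<open>i\<close> moved into \<open>J\<close>.\<close>
    have sl: "slice_space h I (insert i J) (c(i := k)) = {x \<in> slice_space h I J c. g k x = 0}"
      using i by (auto simp: slice_space_def g_def)
    have "euler_sum E = (if k \<in> A then e' else 0)"
    proof (cases "k \<in> A")
      case True
      have "euler_sum E = - ((-1) ^ card (I - insert i J))"
      proof (rule Suc.hyps(1)[OF card(1) _ E(1)])
        show "insert i J \<subseteq> I" using Suc.prems(1) i by simp
        show "{x\<in>F. g k x = 0} \<subseteq> slice_space h I (insert i J) (c(i := k))"
          using sub unfolding sl by blast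
        show "{x\<in>F. g k x = 0} \<noteq> {}" using True by (auto simp: A_def)
        show "x h > 0" if "x \<in> {x\<in>F. g k x = 0}" for x using height that by blast
        show "a *\<^sub>R x + b *\<^sub>R y \<in> {x\<in>F. g k x = 0}"
          if "x \<in> {x\<in>F. g k x = 0}" "y \<in> {x\<in>F. g k x = 0}" "a > 0" "b > 0" for x y a b
          using that conv by (simp add: linear_add[OF lin] linear_scale[OF lin])
        fix x u assume x: "x \<in> {x\<in>F. g k x = 0}" and "u \<in> slice_space h I (insert i J) (c(i := k))"
        then have u: "u \<in> slice_space h I J c" "g k u = 0" unfolding sl by auto
        obtain \<epsilon> where "\<epsilon> > 0" "\<forall>s. \<bar>s\<bar> < \<epsilon> \<longrightarrow> x + s *\<^sub>R u \<in> F" using op[OF _ u(1)] x by blast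
        moreover have "g k (x + s *\<^sub>R u) = 0" for s
          using x u by (simp add: linear_add[OF lin] linear_scale[OF lin])
        ultimately show "\<exists>\<epsilon>>0. \<forall>s. \<bar>s\<bar> < \<epsilon> \<longrightarrow> x + s *\<^sub>R u \<in> {x\<in>F. g k x = 0}" by blast
      qed
      then show ?thesis using True by (simp add: e'_def)
    next
      case False
      then have "{x\<in>F. g k x = 0} = {}" by (auto simp: A_def)
      then have "E = {}" using conic_partitionD(5)[OF E(1)] rcone_nonempty by blast
      then show ?thesis using False by (simp add: euler_sum_def)
    qed
    then show ?thesis using E(2) by simp
  qed
  define R where "R = (\<Union>V\<in>D. \<rho> ` V)"
  have finR: "finite R" unfolding R_def using D(1,2) by blast
  \<comment> \<open>A cell with a point of slope \<open>k\<close> has generators of slope at least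
    \<open>k\<close> and of slope at most \<open>k\<close>; otherwise \<open>g k\<close> would have
    a strict sign on it.\<close>
  have bdd: "Min R \<le> k \<and> k \<le> Max R" if k: "k \<in> A" for k
  proof -
    obtain x V where x: "x \<in> rcone V" "V \<in> D" "g k x = 0"
      using k D(7) unfolding A_def by blast
    have "\<exists>v\<in>V. g k v \<ge> 0"
    proof (rule ccontr)
      assume "\<not> ?thesis"
      then have *: "\<forall>v\<in>V. g k v < 0" by (auto simp: not_le)
      have "\<forall>v\<in>V. g k v \<le> 0" "\<exists>v\<in>V. g k v < 0"
        using * neV[OF x(2)] by (auto intro: less_imp_le)
      then show False using linear_rcone_neg[OF lin D(2)[OF x(2)] x(1)] x(3) by fastforce
    qed
    then obtain v where v: "v \<in> V" "g k v \<ge> 0" by blast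
    have "\<exists>v\<in>V. g k v \<le> 0"
    proof (rule ccontr)
      assume "\<not> ?thesis"
      then have *: "\<forall>v\<in>V. g k v > 0" by (auto simp: not_le)
      have "\<forall>v\<in>V. g k v \<ge> 0" "\<exists>v\<in>V. g k v > 0"
        using * neV[OF x(2)] by (auto intro: less_imp_le)
      then show False using linear_rcone_pos[OF lin D(2)[OF x(2)] x(1)] x(3) by fastforce
    qed
    then obtain w where w: "w \<in> V" "g k w \<le> 0" by blast
    have "k \<le> \<rho> v" "\<rho> w \<le> k"
      using v w heightV[OF x(2)] by (auto simp: \<rho>_def g_def field_simps)
    moreover have "\<rho> v \<in> R" "\<rho> w \<in> R" using v w x(2) by (auto simp: R_def)
    ultimately show ?thesis using Max_ge[OF finR] Min_le[OF finR] by fastforce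
  qed
  have inA: "x i / x h \<in> A" if "x \<in> F" for x
  proof -
    have "g (x i / x h) x = 0" using height[OF that] by (simp add: g_def)
    then show ?thesis unfolding A_def using that by blast
  qed
  have Aex: "\<exists>x\<in>F. k = x i / x h" if k: "k \<in> A" for k
  proof -
    obtain x where "x \<in> F" "g k x = 0" using k by (auto simp: A_def)
    then show ?thesis using height[of x] by (intro bexI[of _ x]) (auto simp: g_def field_simps)
  qed
  have between: "k \<in> A" if jm: "j \<in> A" "m \<in> A" "j < k" "k < m" for j k m
  proof -
    obtain x y where xy: "x \<in> F" "y \<in> F" "j = x i / x h" "m = y i / y h" using Aex jm by meson
    \<comment> \<open>Scaled to height 1, \<open>x\<close> and \<open>y\<close> have slopes
      \<open>j\<close> and \<open>m\<close>. The barycentric weights of \<open>k\<close> between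
      them are proportional to \<open>m - k\<close> and \<open>k - j\<close>.\<close>
    define z where "z = ((m - k) / x h) *\<^sub>R x + ((k - j) / y h) *\<^sub>R y"
    have h: "x h > 0" "y h > 0" using height xy by auto
    have "z \<in> F" unfolding z_def using xy h jm by (intro conv) auto
    moreover have "g k z = 0"
    proof -
      have "z i = (m - k) * j + (k - j) * m" "z h = m - j"
        using h by (simp_all add: z_def xy(3,4))
      then have "g k z = (m - k) * j + (k - j) * m - k * (m - j)"
        by (simp only: g_def)
      then show ?thesis by (simp add: algebra_simps)
    qed
    ultimately show ?thesis by (auto simp: A_def)
  qed
  have opA: "\<exists>\<epsilon>>0. \<forall>s. \<bar>s\<bar> < \<epsilon> \<longrightarrow> k + s \<in> A" if k: "k \<in> A" for k
  proof -
    obtain x where x: "x \<in> F" "k = x i / x h" using Aex[OF k] by blast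
    have hx: "x h > 0" using height x by auto
    \<comment> \<open>This direction leaves the height and the slopes in \<open>J\<close> unchanged
      while the slope at \<open>i\<close> moves.\<close>
    define u where "u = (\<lambda>j. if j = i then 1 else 0 :: real)"
    have "u \<in> slice_space h I J c"
      using i \<open>i \<noteq> h\<close> by (auto simp: slice_space_def u_def)
    then obtain \<epsilon> where \<epsilon>: "\<epsilon> > 0" "\<forall>s. \<bar>s\<bar> < \<epsilon> \<longrightarrow> x + s *\<^sub>R u \<in> F" using op x by blast
    show ?thesis
    proof (intro exI[of _ "\<epsilon> / x h"] conjI allI impI)
      show "\<epsilon> / x h > 0" using \<epsilon> hx by simp
      fix s assume "\<bar>s\<bar> < \<epsilon> / x h"
      then have "\<bar>s * x h\<bar> < \<epsilon>" using hx by (simp add: abs_mult field_simps)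
      then have "x + (s * x h) *\<^sub>R u \<in> F" using \<epsilon> by blast
      from inA[OF this] show "k + s \<in> A"
        using hx \<open>i \<noteq> h\<close> by (simp add: u_def x add_divide_distrib)
    qed
  qed
  have "A \<noteq> {}" using ne inA by blast
  then obtain a b where ab: "a < b" "A = {a<..<b}"
    by (rule open_convex_real_interval[OF _ bdd between opA])
  \<comment> \<open>All slopes at which the profile of a cell or that of \<open>A\<close> can
    jump.\<close>
  define C where "C = insert a (insert b R)"
  have C: "finite C" "a \<in> C" "b \<in> C" unfolding C_def using finR by auto
  obtain \<epsilon> where \<epsilon>: "\<epsilon> > 0" "\<And>c c'. c \<in> C \<Longrightarrow> c' \<in> C \<Longrightarrow> c < c' \<Longrightarrow> c + \<epsilon> < c'"
    using finite_real_gap[OF C(1)] by blast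
  have prof: "(\<Sum>V\<in>D. (-1) ^ card V * cut_profile (Min (\<rho> ` V)) (Max (\<rho> ` V)) k) = - e' * cut_profile a b k" for k
  proof -
    have "(\<Sum>V\<in>D. (-1) ^ card V * cut_profile (Min (\<rho> ` V)) (Max (\<rho> ` V)) k) = (if k \<in> A then e' else 0)"
      unfolding slice[symmetric] g_def \<rho>_def
      using cut_weight_profile[OF D(2) neV] heightV by (intro sum.cong) auto
    \<comment> \<open>On the open interval \<open>A\<close> the profile is -1 and elsewhere 0, since
      \<open>a < b\<close>; this is where the sign flips with each dimension.\<close>
    also have "\<dots> = - e' * cut_profile a b k"
      using ab by (auto simp: cut_profile_def)
    finally show ?thesis .
  qed
  \<comment> \<open>Each cell is weighted by 1, written as the jump sum of its own profile. After
    exchanging the sums the cells enter only through \<open>prof\<close>, that is, through the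
    slices.\<close>
  have "euler_sum D = (\<Sum>V\<in>D. (-1) ^ card V *
      (\<Sum>k\<in>C. cut_profile (Min (\<rho> ` V)) (Max (\<rho> ` V)) k - cut_profile (Min (\<rho> ` V)) (Max (\<rho> ` V)) (k + \<epsilon>)))"
    unfolding euler_sum_def
  proof (rule sum.cong[OF refl])
    fix V assume V: "V \<in> D"
    have f: "finite (\<rho> ` V)" "\<rho> ` V \<noteq> {}" "\<rho> ` V \<subseteq> C"
      using D(2)[OF V] neV[OF V] V by (auto simp: C_def R_def)
    have "(\<Sum>k\<in>C. cut_profile (Min (\<rho> ` V)) (Max (\<rho> ` V)) k - cut_profile (Min (\<rho> ` V)) (Max (\<rho> ` V)) (k + \<epsilon>)) = 1"
      using f(3) Min_in[OF f(1,2)] Max_in[OF f(1,2)] Min_le[OF f(1)] C(1) \<epsilon>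
      by (intro cut_profile_jump_sum) auto
    then show "(-1) ^ card V = (-1) ^ card V *
      (\<Sum>k\<in>C. cut_profile (Min (\<rho> ` V)) (Max (\<rho> ` V)) k - cut_profile (Min (\<rho> ` V)) (Max (\<rho> ` V)) (k + \<epsilon>))"
      by simp
  qed
  also have "\<dots> = (\<Sum>V\<in>D. \<Sum>k\<in>C. (-1) ^ card V * cut_profile (Min (\<rho> ` V)) (Max (\<rho> ` V)) k -
      (-1) ^ card V * cut_profile (Min (\<rho> ` V)) (Max (\<rho> ` V)) (k + \<epsilon>))"
    by (simp add: sum_distrib_left right_diff_distrib)
  also have "\<dots> = (\<Sum>k\<in>C. \<Sum>V\<in>D. (-1) ^ card V * cut_profile (Min (\<rho> ` V)) (Max (\<rho> ` V)) k -
      (-1) ^ card V * cut_profile (Min (\<rho> ` V)) (Max (\<rho> ` V)) (k + \<epsilon>))"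
    by (rule sum.swap)
  also have "\<dots> = (\<Sum>k\<in>C. - e' * cut_profile a b k - - e' * cut_profile a b (k + \<epsilon>))"
    by (simp only: sum_subtractf prof)
  also have "\<dots> = - e' * (\<Sum>k\<in>C. cut_profile a b k - cut_profile a b (k + \<epsilon>))"
    by (simp add: sum_distrib_left right_diff_distrib)
  also have "\<dots> = - e'"
    using cut_profile_jump_sum[OF C less_imp_le[OF ab(1)] \<epsilon>] by simp
  finally show ?case using card(2) by (simp add: e'_def)
qed

section \<open>Lattice points in a simplicial cone\<close>

text \<open>Only \<open>t \<ge> 1\<close> is constrained: \<open>e\<close> is the value at \<open>0\<close> of the constituent for \<open>t\<close> divisible by the period,
  not \<open>F 0\<close>.\<close>

definition ehrhart :: "(nat \<Rightarrow> real) \<Rightarrow> real \<Rightarrow> bool" where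
  "ehrhart F e \<longleftrightarrow> (\<exists>P>0. \<exists>Q :: nat \<Rightarrow> real poly.
     (\<forall>t\<ge>1. F t = poly (Q (t mod P)) (real t)) \<and> poly (Q 0) 0 = e)"

lemma ehrhart_add:
  assumes "ehrhart F d" "ehrhart G e"
  shows "ehrhart (\<lambda>t. F t + G t) (d + e)"
proof -
  obtain P Q where P: "P > 0" "\<forall>t\<ge>1. F t = poly (Q (t mod P)) (real t)" "poly (Q 0) 0 = d"
    using assms(1) unfolding ehrhart_def by blast
  obtain P' Q' where P': "P' > 0" "\<forall>t\<ge>1. G t = poly (Q' (t mod P')) (real t)" "poly (Q' 0) 0 = e"
    using assms(2) unfolding ehrhart_def by blast
  show ?thesis
    unfolding ehrhart_def
  proof (intro exI conjI)
    show "P * P' > 0" using P P' by simp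
    show "\<forall>t\<ge>1. F t + G t = poly ((\<lambda>r. Q (r mod P) + Q' (r mod P')) (t mod (P * P'))) (real t)"
      using P P' by (simp add: mod_mod_cancel)
    show "poly ((\<lambda>r. Q (r mod P) + Q' (r mod P')) 0) 0 = d + e"
      using P P' by simp
  qed
qed

lemma ehrhart_sum:
  assumes "finite A" "\<And>a. a \<in> A \<Longrightarrow> ehrhart (F a) (e a)"
  shows "ehrhart (\<lambda>t. \<Sum>a\<in>A. F a t) (\<Sum>a\<in>A. e a)"
  using assms
proof (induction A)
  case empty
  show ?case unfolding ehrhart_def by (intro exI[of _ 1] conjI exI[of _ "\<lambda>_. 0"]) auto
qed (simp add: ehrhart_add)

section \<open>Weak compositions and their counting polynomial\<close>

lemma card_weak_compositions:
  assumes "finite V" "V \<noteq> {}"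
  shows "card {N \<in> V \<rightarrow>\<^sub>E (UNIV :: nat set). sum N V = m} = (m + card V - 1) choose (card V - 1)"
    and "finite {N \<in> V \<rightarrow>\<^sub>E (UNIV :: nat set). sum N V = m}"
proof -
  obtain vs where vs: "distinct vs" "set vs = V" using finite_distinct_list[OF assms(1)] by blast
  have len: "length vs = card V" using vs distinct_card by fastforce
  let ?L = "{l :: nat list. size l = card V \<and> sum_list l = m}"
  have "bij_betw (\<lambda>N. map N vs) {N \<in> V \<rightarrow>\<^sub>E (UNIV :: nat set). sum N V = m} ?L"
  proof (rule bij_betwI')
    fix N N' assume "N \<in> {N \<in> V \<rightarrow>\<^sub>E (UNIV :: nat set). sum N V = m}" "N' \<in> {N \<in> V \<rightarrow>\<^sub>E (UNIV :: nat set). sum N V = m}"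
    then have N: "N \<in> V \<rightarrow>\<^sub>E (UNIV :: nat set)" "N' \<in> V \<rightarrow>\<^sub>E (UNIV :: nat set)" by blast+
    show "(map N vs = map N' vs) = (N = N')"
      using PiE_ext[OF N] vs(2) by (metis map_eq_conv)
  next
    fix N assume "N \<in> {N \<in> V \<rightarrow>\<^sub>E (UNIV :: nat set). sum N V = m}"
    then show "map N vs \<in> ?L"
      using vs len by (auto simp: sum_list_distinct_conv_sum_set)
  next
    fix l assume l: "l \<in> ?L"
    define N where "N = (\<lambda>v\<in>V. the (map_of (zip vs l) v))"
    have eq: "map N vs = l"
    proof (rule nth_equalityI)
      show "length (map N vs) = length l" using l len by simp
      fix k assume "k < length (map N vs)"
      then have k: "k < length vs" by simp
      then have "map_of (zip vs l) (vs ! k) = Some (l ! k)"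
        using l len vs(1) by (intro map_of_zip_nth) auto
      then show "map N vs ! k = l ! k"
        using k vs(2) nth_mem[OF k] by (simp add: N_def)
    qed
    moreover have "sum N V = m"
      using l sum_list_distinct_conv_sum_set[OF vs(1), of N] vs(2) eq by simp
    ultimately show "\<exists>N\<in>{N \<in> V \<rightarrow>\<^sub>E (UNIV :: nat set). sum N V = m}. l = map N vs"
      by (intro bexI[of _ N]) (auto simp: N_def)
  qed
  note bij = this
  have fL: "finite ?L"
  proof (rule finite_subset)
    show "?L \<subseteq> {l. set l \<subseteq> {..m} \<and> length l = card V}" using member_le_sum_list by fastforce
    show "finite {l. set l \<subseteq> {..m} \<and> length l = card V}" by (rule finite_lists_length_eq) simp
  qed
  show "finite {N \<in> V \<rightarrow>\<^sub>E (UNIV :: nat set). sum N V = m}"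
    using bij fL by (simp add: bij_betw_finite)
  have "card {N \<in> V \<rightarrow>\<^sub>E (UNIV :: nat set). sum N V = m} = (m + card V - 1) choose m"
    using bij_betw_same_card[OF bij] card_length_sum_list[of "card V" m] by simp
  also have "\<dots> = (m + card V - 1) choose (card V - 1)"
    using assms by (subst binomial_symmetric) (auto simp: card_gt_0_iff Suc_le_eq)
  finally show "card {N \<in> V \<rightarrow>\<^sub>E (UNIV :: nat set). sum N V = m} = (m + card V - 1) choose (card V - 1)" .
qed

text \<open>The binomial coefficient m + k - 1 over k - 1 as a polynomial in m: the number of weak
  compositions of m into k parts, for \<open>k \<ge> 1\<close>. Its zeros are -1, ..., -(k -
  1).\<close>

definition choose_poly :: "nat \<Rightarrow> real poly" where
  "choose_poly k = smult (1 / fact (k - 1)) (\<Prod>i\<in>{1..<k}. [:real i, 1:])"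

lemma poly_choose_poly: "poly (choose_poly k) x = (\<Prod>i\<in>{1..<k}. x + real i) / fact (k - 1)"
  by (simp add: choose_poly_def poly_prod add.commute)

lemma choose_poly_nat:
  assumes "k \<ge> 1"
  shows "poly (choose_poly k) (real m) = real ((m + k - 1) choose (k - 1))"
proof -
  obtain l where k: "k = Suc l" using assms by (cases k) auto
  have "(\<Prod>i\<in>{1..<Suc l}. real m + real i) * fact m = fact (m + l)"
  proof (induction l)
    case (Suc l)
    have "(\<Prod>i\<in>{1..<Suc (Suc l)}. real m + real i) =
        (\<Prod>i\<in>{1..<Suc l}. real m + real i) * (real m + real (Suc l))"
      by (rule prod.atLeastLessThan_Suc) simp
    then have "(\<Prod>i\<in>{1..<Suc (Suc l)}. real m + real i) * fact m =
        ((\<Prod>i\<in>{1..<Suc l}. real m + real i) * fact m) * (real m + real (Suc l))"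
      by (simp only: mult_ac)
    also have "\<dots> = fact (m + l) * real (m + Suc l)"
      unfolding Suc.IH by simp
    also have "\<dots> = fact (m + Suc l)" by (simp add: algebra_simps)
    finally show ?case .
  qed simp
  then have "(\<Prod>i\<in>{1..<Suc l}. real m + real i) = fact (m + l) / fact m"
    by (simp add: field_simps)
  moreover have "real ((m + l) choose l) = fact (m + l) / (fact l * fact m)"
    by (subst binomial_fact) auto
  ultimately show ?thesis by (simp add: poly_choose_poly k)
qed

text \<open>Thanks to these zeros one polynomial also gives the count 0 at positive heights below
  that of a box point.\<close>

lemma choose_poly_neg:
  assumes "1 \<le> i" "i < k"
  shows "poly (choose_poly k) (- real i) = 0"
  using assms by (auto simp: poly_choose_poly intro!: prod_zero bexI[of _ i])

text \<open>The first negative integer past the zeros. In \<open>ehrhart_rcone\<close> only the far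
  corner of the box reaches it, and it yields the whole value at t = 0.\<close>

lemma choose_poly_minus_k:
  assumes "k \<ge> 1"
  shows "poly (choose_poly k) (- real k) = - ((-1) ^ k)"
proof -
  obtain l where k: "k = Suc l" using assms by (cases k) auto
  have "(\<Prod>i\<in>{1..<k}. - real k + real i) = (\<Prod>i\<in>{1..<k}. (-1) * real (k - i))"
    by (intro prod.cong) auto
  also have "\<dots> = (-1) ^ l * (\<Prod>i\<in>{1..<k}. real (k - i))"
    by (subst prod.distrib) (simp add: k)
  also have "(\<Prod>i\<in>{1..<k}. real (k - i)) = (\<Prod>i\<in>{1..<k}. real i)"
    by (rule prod.reindex_bij_witness[of _ "\<lambda>i. k - i" "\<lambda>i. k - i"]) auto
  also have "\<dots> = fact l"
    unfolding fact_prod k by (simp add: atLeastLessThanSuc_atLeastAtMost)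
  finally show ?thesis by (simp add: poly_choose_poly k)
qed


lemma independent_coeffs_unique:
  assumes "finite V" "independent V" "(\<Sum>v\<in>V. a v *\<^sub>R v) = (\<Sum>v\<in>V. b v *\<^sub>R v)" "v \<in> V"
  shows "a v = b v"
proof -
  have "(\<Sum>v\<in>V. (a v - b v) *\<^sub>R v) = 0"
    using assms(3) by (simp add: scaleR_left_diff_distrib sum_subtractf)
  then have "a v - b v = 0" using assms by (intro independentD[of V V]) auto
  then show ?thesis by simp
qed

text \<open>
  Every lattice point of the cone is uniquely a lattice point of the half-open box with edges
  \<open>s v\<close> times the generators plus a natural combination of these edges, all of which have height \<open>P\<close>.
\<close>

lemma ehrhart_rcone:
  fixes \<tau> :: "'v::real_vector \<Rightarrow> real" and \<Lambda> :: "'v set"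
  assumes \<tau>: "linear \<tau>" and V: "finite V" "independent V" "V \<noteq> {}" "V \<subseteq> \<Lambda>" "\<And>v. v \<in> V \<Longrightarrow> \<tau> v > 0"
    and \<Lambda>: "0 \<in> \<Lambda>" "\<And>x y. x \<in> \<Lambda> \<Longrightarrow> y \<in> \<Lambda> \<Longrightarrow> x + y \<in> \<Lambda>" "\<And>x y. x \<in> \<Lambda> \<Longrightarrow> y \<in> \<Lambda> \<Longrightarrow> x - y \<in> \<Lambda>"
      "\<And>x. x \<in> \<Lambda> \<Longrightarrow> \<tau> x \<in> \<int>"
    and box: "\<And>s. finite (\<Lambda> \<inter> {\<Sum>v\<in>V. \<mu> v *\<^sub>R v | \<mu>. \<forall>v\<in>V. 0 < \<mu> v \<and> \<mu> v \<le> s})"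
  shows "ehrhart (\<lambda>t. real (card {x \<in> \<Lambda> \<inter> rcone V. \<tau> x = real t})) (- ((-1) ^ card V))"
    and "finite {x \<in> \<Lambda> \<inter> rcone V. \<tau> x = real t}"
proof -
  define k where "k = card V"
  have k: "k \<ge> 1" using V by (simp add: k_def card_gt_0_iff Suc_le_eq)
  have nat_scale: "real n *\<^sub>R x \<in> \<Lambda>" if "x \<in> \<Lambda>" for n x
    using that \<Lambda>(1,2) by (induction n) (auto simp: scaleR_left_distrib)
  have sum_in: "(\<Sum>v\<in>V. f v) \<in> \<Lambda>" if "\<And>v. v \<in> V \<Longrightarrow> f v \<in> \<Lambda>" for f
    using V(1) that \<Lambda>(1,2) by (induction V) auto
  define h where "h v = nat \<lfloor>\<tau> v\<rfloor>" for v
  have h: "\<tau> v = real (h v)" if "v \<in> \<Lambda>" "\<tau> v > 0" for v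
    using that \<Lambda>(4)[OF that(1)] by (auto simp: h_def elim!: Ints_cases)
  have hV: "\<tau> v = real (h v)" "h v > 0" if "v \<in> V" for v
    using h[of v] V(4,5) that by force+
  \<comment> \<open>A common multiple of the heights: stretched by \<open>s v\<close>, all edges get
    the same height \<open>P\<close>, so a shift raises the height by \<open>P\<close> times its
    number of edges, whichever they are.\<close>
  define P where "P = (\<Prod>v\<in>V. h v)"
  have P: "P > 0" using hV V(1) by (auto simp: P_def intro!: prod_pos)
  define s where "s v = P div h v" for v
  have s: "s v * h v = P" "s v > 0" if "v \<in> V" for v
  proof -
    have "h v dvd P" unfolding P_def using V(1) that by (rule dvd_prodI)
    then show "s v * h v = P" by (simp add: s_def)
    then show "s v > 0" using P by (metis gr0I mult_0)
  qed
  have s\<tau>: "real (s v) * \<tau> v = real P" if "v \<in> V" for v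
    using s(1)[OF that] hV(1)[OF that] by (metis of_nat_mult)
  define comb where "comb \<mu> = (\<Sum>v\<in>V. \<mu> v *\<^sub>R v)" for \<mu> :: "'v \<Rightarrow> real"
  have comb_add: "comb \<mu> + comb \<nu> = comb (\<lambda>v. \<mu> v + \<nu> v)" for \<mu> \<nu>
    by (simp add: comb_def scaleR_left_distrib sum.distrib)
  have \<tau>comb: "\<tau> (comb \<mu>) = (\<Sum>v\<in>V. \<mu> v * \<tau> v)" for \<mu>
    by (simp add: comb_def linear_sum[OF \<tau>] linear_scale[OF \<tau>])
  \<comment> \<open>Open at 0 and closed at \<open>s v\<close>: the translates of this interval by
    natural multiples of \<open>s v\<close> tile the positive reals exactly.\<close>
  define inbox where "inbox \<mu> \<longleftrightarrow> (\<forall>v\<in>V. 0 < \<mu> v \<and> \<mu> v \<le> real (s v))" for \<mu>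
  define Box where "Box = {x \<in> \<Lambda>. \<exists>\<mu>. inbox \<mu> \<and> x = comb \<mu>}"
  have finBox: "finite Box"
  proof (rule finite_subset[OF _ box[of "real P"]])
    have "s v \<le> P" if "v \<in> V" for v unfolding s_def by (rule div_le_dividend)
    then show "Box \<subseteq> \<Lambda> \<inter> {\<Sum>v\<in>V. \<mu> v *\<^sub>R v | \<mu>. \<forall>v\<in>V. 0 < \<mu> v \<and> \<mu> v \<le> real P}"
    proof (intro subsetI)
      fix p assume "p \<in> Box"
      then obtain \<mu> where \<mu>: "inbox \<mu>" "p = comb \<mu>" and "p \<in> \<Lambda>" unfolding Box_def by blast
      moreover have "\<forall>v\<in>V. 0 < \<mu> v \<and> \<mu> v \<le> real P"
        using \<mu>(1) \<open>\<And>v. v \<in> V \<Longrightarrow> s v \<le> P\<close> unfolding inbox_def by (meson of_nat_le_iff order_trans)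
      ultimately show "p \<in> \<Lambda> \<inter> {\<Sum>v\<in>V. \<mu> v *\<^sub>R v | \<mu>. \<forall>v\<in>V. 0 < \<mu> v \<and> \<mu> v \<le> real P}"
        unfolding comb_def by blast
    qed
  qed
  define shift where "shift N = comb (\<lambda>v. real (N v * s v))" for N :: "'v \<Rightarrow> nat"
  have shift\<Lambda>: "shift N \<in> \<Lambda>" for N
    unfolding shift_def comb_def using V(4) by (intro sum_in nat_scale) auto
  have \<tau>shift: "\<tau> (shift N) = real (P * sum N V)" for N
  proof -
    have "\<tau> (shift N) = (\<Sum>v\<in>V. real (N v) * (real (s v) * \<tau> v))"
      by (simp add: shift_def \<tau>comb mult.assoc)
    also have "\<dots> = (\<Sum>v\<in>V. real (N v) * real P)" using s\<tau> by (intro sum.cong) auto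
    finally show ?thesis by (simp add: sum_distrib_left mult.commute)
  qed
  have Box_h: "\<tau> p = real (h p)" "h p > 0" "h p \<le> k * P" if p: "p \<in> Box" for p
  proof -
    obtain \<mu> where \<mu>: "inbox \<mu>" "p = comb \<mu>" "p \<in> \<Lambda>" using p unfolding Box_def by blast
    have "\<tau> p > 0" unfolding \<mu>(2) \<tau>comb using \<mu>(1) V by (intro sum_pos) (auto simp: inbox_def)
    then show "\<tau> p = real (h p)" using h \<mu>(3) by blast
    with \<open>\<tau> p > 0\<close> show "h p > 0" by simp
    have "\<tau> p \<le> (\<Sum>v\<in>V. real P)"
      unfolding \<mu>(2) \<tau>comb
    proof (rule sum_mono)
      fix v assume v: "v \<in> V"
      then show "\<mu> v * \<tau> v \<le> real P"
        unfolding s\<tau>[OF v, symmetric] using \<mu>(1) V(5)[OF v] by (intro mult_right_mono) (auto simp: inbox_def)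
    qed
    then have "real (h p) \<le> real (k * P)" using \<open>\<tau> p = real (h p)\<close> by (simp add: k_def)
    then show "h p \<le> k * P" by (simp only: of_nat_le_iff)
  qed
  \<comment> \<open>The far corner, the only box point of the maximal height \<open>k * P\<close>.
    It will be the only one to contribute at t = 0.\<close>
  define top where "top = comb (\<lambda>v. real (s v))"
  have top: "top \<in> Box" "h top = k * P"
  proof -
    have "top = shift (\<lambda>_. 1)" by (simp add: top_def shift_def)
    then have "top \<in> \<Lambda>" "\<tau> top = real (k * P)" using shift\<Lambda> \<tau>shift by (simp_all add: k_def)
    moreover have "inbox (\<lambda>v. real (s v))" using s(2) by (simp add: inbox_def)
    ultimately show "top \<in> Box" unfolding Box_def top_def by blast
    then have "real (h top) = real (k * P)" using Box_h(1) \<open>\<tau> top = _\<close> by simp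
    then show "h top = k * P" by (simp only: of_nat_eq_iff)
  qed
  have top_unique: "p = top" if p: "p \<in> Box" "h p = k * P" for p
  proof -
    obtain \<mu> where \<mu>: "inbox \<mu>" "p = comb \<mu>" using p by (auto simp: Box_def)
    have "\<mu> v = real (s v)" if v: "v \<in> V" for v
    proof (rule ccontr)
      assume "\<mu> v \<noteq> real (s v)"
      then have "\<mu> v < real (s v)" using \<mu>(1) v by (force simp: inbox_def)
      then have "\<exists>v\<in>V. \<mu> v * \<tau> v < real (s v) * \<tau> v" using v V(5)[OF v] mult_strict_right_mono by blast
      moreover have "\<forall>v\<in>V. \<mu> v * \<tau> v \<le> real (s v) * \<tau> v"
        using \<mu>(1) V(5) by (auto simp: inbox_def less_imp_le)
      ultimately have "\<tau> p < \<tau> top"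
        unfolding \<mu>(2) top_def \<tau>comb using V(1) by (intro sum_strict_mono_ex1) auto
      then show False using Box_h(1) p top by simp
    qed
    then show ?thesis unfolding \<mu>(2) top_def comb_def by (intro sum.cong) auto
  qed
  define S where "S t = {x \<in> \<Lambda> \<inter> rcone V. \<tau> x = real t}" for t
  define T where "T t p = {N \<in> V \<rightarrow>\<^sub>E (UNIV :: nat set). h p + P * sum N V = t}" for t p
  have bij: "bij_betw (\<lambda>(p, N). p + shift N) (Sigma Box (T t)) (S t)" for t
  proof (rule bij_betwI')
    fix a b assume "a \<in> Sigma Box (T t)" "b \<in> Sigma Box (T t)"
    then obtain p N q M where ab: "a = (p, N)" "b = (q, M)" "p \<in> Box" "q \<in> Box" "N \<in> T t p" "M \<in> T t q"
      by auto
    obtain \<mu> \<nu> where \<mu>: "inbox \<mu>" "p = comb \<mu>" "inbox \<nu>" "q = comb \<nu>" using ab by (auto simp: Box_def)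
    have "p = q \<and> N = M" if eq: "p + shift N = q + shift M"
    proof -
      have "N v = M v" if v: "v \<in> V" for v
      proof -
        have "\<mu> v + real (N v * s v) = \<nu> v + real (M v * s v)"
          using eq unfolding \<mu> shift_def comb_add unfolding comb_def
          by (rule independent_coeffs_unique[OF V(1,2) _ v])
        then have "(real (N v) - real (M v)) * real (s v) = \<nu> v - \<mu> v" by (simp add: algebra_simps)
        \<comment> \<open>Both coefficients lie in the same half-open interval of length
          \<open>s v\<close>, so they cannot differ by a nonzero multiple of it.\<close>
        moreover have "\<bar>\<nu> v - \<mu> v\<bar> < real (s v)" using \<mu>(1,3) v by (force simp: inbox_def)
        ultimately have "\<bar>real (N v) - real (M v)\<bar> * real (s v) < 1 * real (s v)"
          by (metis abs_mult abs_of_nat mult_1)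
        then have "\<bar>real (N v) - real (M v)\<bar> < 1"
          by (rule mult_right_less_imp_less) simp
        then show ?thesis by linarith
      qed
      then have "N = M" using ab by (intro PiE_ext[of N V "\<lambda>_. UNIV" M]) (auto simp: T_def)
      then show ?thesis using eq by simp
    qed
    then show "((case a of (p, N) \<Rightarrow> p + shift N) = (case b of (p, N) \<Rightarrow> p + shift N)) = (a = b)"
      using ab by auto
  next
    fix a assume "a \<in> Sigma Box (T t)"
    then obtain p N where a: "a = (p, N)" "p \<in> Box" "N \<in> T t p" by auto
    obtain \<mu> where \<mu>: "inbox \<mu>" "p = comb \<mu>" "p \<in> \<Lambda>" using a unfolding Box_def by blast
    have "p + shift N \<in> rcone V"
      unfolding \<mu>(2) shift_def comb_add unfolding comb_def using \<mu>(1) by (intro rconeI) (auto simp: inbox_def add_pos_nonneg)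
    moreover have "\<tau> (p + shift N) = real t"
      using a Box_h(1)[OF a(2)] by (auto simp: linear_add[OF \<tau>] \<tau>shift T_def)
    ultimately show "(case a of (p, N) \<Rightarrow> p + shift N) \<in> S t"
      using a \<mu> shift\<Lambda> \<Lambda>(2) by (auto simp: S_def)
  next
    fix x assume x: "x \<in> S t"
    then obtain l where l: "\<forall>v\<in>V. l v > 0" "x = comb l" by (auto simp: S_def rcone_def comb_def)
    \<comment> \<open>Ceiling minus one instead of the floor, so that the remainder falls in the
      interval that excludes 0 and includes \<open>s v\<close>.\<close>
    define N where "N = (\<lambda>v\<in>V. nat (\<lceil>l v / real (s v)\<rceil> - 1))"
    define \<mu> where "\<mu> v = l v - real (N v * s v)" for v
    have "inbox \<mu>"
      unfolding inbox_def
    proof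
      fix v assume v: "v \<in> V"
      have sv: "real (s v) > 0" using s(2)[OF v] by simp
      have "l v / real (s v) > 0" using l(1) v sv by simp
      then have "\<lceil>l v / real (s v)\<rceil> \<ge> 1" by linarith
      then have "real (N v) = of_int \<lceil>l v / real (s v)\<rceil> - 1" using v by (simp add: N_def)
      then have "real (N v) < l v / real (s v)" "l v / real (s v) \<le> real (N v) + 1" by linarith+
      then have "real (N v) * real (s v) < l v" "l v \<le> (real (N v) + 1) * real (s v)"
        using sv by (simp_all add: field_simps)
      then show "0 < \<mu> v \<and> \<mu> v \<le> real (s v)" by (simp add: \<mu>_def algebra_simps)
    qed
    have xeq: "x = comb \<mu> + shift N" unfolding shift_def comb_add l(2) by (simp add: \<mu>_def)
    then have "comb \<mu> = x - shift N" by simp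
    then have "comb \<mu> \<in> \<Lambda>" using \<Lambda>(3) x shift\<Lambda> by (auto simp: S_def)
    then have p: "comb \<mu> \<in> Box" using \<open>inbox \<mu>\<close> by (auto simp: Box_def)
    have "real (h (comb \<mu>) + P * sum N V) = real t"
      using x Box_h(1)[OF p] \<tau>shift[of N] unfolding S_def xeq by (simp add: linear_add[OF \<tau>])
    then have "N \<in> T t (comb \<mu>)" unfolding T_def of_nat_eq_iff by (simp add: N_def)
    then show "\<exists>a\<in>Sigma Box (T t). x = (case a of (p, N) \<Rightarrow> p + shift N)"
      using p xeq by (intro bexI[of _ "(comb \<mu>, N)"]) auto
  qed
  have T_empty: "T t p = {}" if "h p > t \<or> h p mod P \<noteq> t mod P" for t p
    using that by (auto simp: T_def)
  have T_eq: "T (h p + P * m) p = {N \<in> V \<rightarrow>\<^sub>E UNIV. sum N V = m}" for m p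
    using P by (auto simp: T_def)
  have T_cases: "T t p = {} \<or> (\<exists>m. t = h p + P * m)" for t p
    by (auto simp: T_def)
  have finT: "finite (T t p)" for t p
    using T_cases[of t p] T_eq card_weak_compositions(2)[OF V(1,3)] by auto
  show "finite {x \<in> \<Lambda> \<inter> rcone V. \<tau> x = real t}"
    using bij_betw_finite[OF bij[of t]] finBox finT unfolding S_def by auto
  \<comment> \<open>The count for \<open>t = h p + P * m\<close> as a polynomial in
    \<open>t\<close>, with \<open>m\<close> replaced by (t - h p) / P.\<close>
  define R where "R p = pcompose (choose_poly k) [: - real (h p) / real P, 1 / real P :]" for p
  have R: "poly (R p) x = poly (choose_poly k) ((x - real (h p)) / real P)" for p x
    by (simp add: R_def poly_pcompose diff_divide_distrib)
  define Q where "Q r = (\<Sum>p\<in>{p\<in>Box. h p mod P = r}. R p)" for r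
  have card_T: "real (card (T t p)) = (if h p mod P = t mod P then poly (R p) (real t) else 0)"
    if "t \<ge> 1" "p \<in> Box" for t p
  proof (cases "h p mod P = t mod P")
    case False
    then show ?thesis using T_empty by simp
  next
    case True
    show ?thesis
    proof (cases "h p \<le> t")
      case le: True
      then have "P dvd t - h p" using True by (metis mod_eq_dvd_iff_nat)
      then obtain m where "t - h p = P * m" by (elim dvdE)
      then have t: "t = h p + P * m" using le by linarith
      have "poly (R p) (real t) = poly (choose_poly k) (real m)"
        using P by (simp add: R t)
      then show ?thesis
        using True card_weak_compositions(1)[OF V(1,3)] choose_poly_nat[OF k]
        unfolding t T_eq by (simp add: k_def)
    next
      case False
      \<comment> \<open>Below the height of \<open>p\<close> there is no shift, and the polynomial
        must vanish. It is evaluated at -i with \<open>i < k\<close>; this uses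
        \<open>t \<ge> 1\<close>, since at \<open>t = 0\<close> the far corner has
        \<open>i = k\<close>.\<close>
      then have "P dvd h p - t" using True by (metis mod_eq_dvd_iff_nat nat_le_linear)
      then obtain i where "h p - t = P * i" by (elim dvdE)
      then have hp: "h p = t + P * i" using False by linarith
      then have "i \<ge> 1" using False by (cases i) auto
      have "P * i < P * k" using hp Box_h(3)[OF that(2)] that(1) mult.commute[of P k] by linarith
      then have "i < k" by simp
      have "poly (R p) (real t) = poly (choose_poly k) (- real i)"
        using P by (simp add: R hp)
      also have "\<dots> = 0" using choose_poly_neg \<open>i \<ge> 1\<close> \<open>i < k\<close> by simp
      finally show ?thesis using T_empty[of t p] False by simp
    qed
  qed
  have "real (card (S t)) = poly (Q (t mod P)) (real t)" if t: "t \<ge> 1" for t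
  proof -
    have "card (S t) = (\<Sum>p\<in>Box. card (T t p))"
      using bij_betw_same_card[OF bij[of t]] finBox finT by (simp add: card_SigmaI)
    then have "real (card (S t)) = (\<Sum>p\<in>Box. if h p mod P = t mod P then poly (R p) (real t) else 0)"
      using card_T[OF t] by simp
    also have "\<dots> = poly (Q (t mod P)) (real t)"
      unfolding Q_def poly_sum using finBox by (simp add: sum.If_cases Int_def)
    finally show ?thesis .
  qed
  moreover have "poly (Q 0) 0 = - ((-1) ^ card V)"
  proof -
    \<comment> \<open>At t = 0 a box point of height \<open>P * i\<close> evaluates its polynomial
      at -i, which is a zero except for the corner, where \<open>i = k\<close>.\<close>
    have "poly (R p) 0 = (if p = top then - ((-1) ^ k) else 0)" if p: "p \<in> Box" "h p mod P = 0" for p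
    proof -
      obtain i where i: "h p = P * i" using p(2) by (auto elim: dvdE)
      have "i \<ge> 1" using Box_h(2)[OF p(1)] i by (cases i) auto
      have "P * i \<le> P * k" using Box_h(3)[OF p(1)] i by (simp add: mult.commute)
      then have "i \<le> k" using P by simp
      have Rp: "poly (R p) 0 = poly (choose_poly k) (- real i)" using P by (simp add: R i)
      show ?thesis
      proof (cases "i = k")
        case True
        then have "p = top" using top_unique p i by (simp add: mult.commute)
        then show ?thesis using Rp True choose_poly_minus_k[OF k] by simp
      next
        case False
        then have "p \<noteq> top" using top(2) i P by (auto simp: mult.commute)
        then show ?thesis using Rp False \<open>i \<ge> 1\<close> \<open>i \<le> k\<close> choose_poly_neg by simp
      qed
    qed
    then have "poly (Q 0) 0 = (\<Sum>p\<in>{p\<in>Box. h p mod P = 0}. if p = top then - ((-1) ^ k) else 0)"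
      unfolding Q_def poly_sum by (intro sum.cong) auto
    also have "\<dots> = - ((-1) ^ k)"
      using finBox top by (simp add: sum.delta)
    finally show ?thesis by (simp add: k_def)
  qed
  ultimately show "ehrhart (\<lambda>t. real (card {x \<in> \<Lambda> \<inter> rcone V. \<tau> x = real t})) (- ((-1) ^ card V))"
    unfolding ehrhart_def S_def using P by blast
qed

section \<open>Lattice points in an open polytope\<close>

definition int_vectors :: "'i set \<Rightarrow> ('i \<Rightarrow> real) set" where
  "int_vectors I = {x. (\<forall>i. x i \<in> \<int>) \<and> (\<forall>i. i \<notin> I \<longrightarrow> x i = 0)}"

lemma finite_bounded_int_vectors:
  assumes "finite I"
  shows "finite {x \<in> int_vectors I. \<forall>i. \<bar>x i\<bar> \<le> b}"
proof (rule finite_subset)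
  let ?Z = "{r :: real. r \<in> \<int> \<and> \<bar>r\<bar> \<le> b}"
  have "?Z \<subseteq> real_of_int ` {- \<lceil>b\<rceil>..\<lceil>b\<rceil>}"
  proof
    fix r assume "r \<in> ?Z"
    then obtain n where n: "r = real_of_int n" "\<bar>real_of_int n\<bar> \<le> b" by (auto elim!: Ints_cases)
    then have "n \<in> {- \<lceil>b\<rceil>..\<lceil>b\<rceil>}" by auto linarith+
    then show "r \<in> real_of_int ` {- \<lceil>b\<rceil>..\<lceil>b\<rceil>}" using n by blast
  qed
  then have fin: "finite ?Z" by (rule finite_subset) simp
  show "finite {x. \<forall>i. (i \<in> I \<longrightarrow> x i \<in> ?Z) \<and> (i \<notin> I \<longrightarrow> x i = 0)}"
    by (rule finite_set_of_finite_funs[OF assms fin])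
  show "{x \<in> int_vectors I. \<forall>i. \<bar>x i\<bar> \<le> b} \<subseteq> {x. \<forall>i. (i \<in> I \<longrightarrow> x i \<in> ?Z) \<and> (i \<notin> I \<longrightarrow> x i = 0)}"
    by (auto simp: int_vectors_def)
qed

lemma finite_int_vectors_box:
  fixes V :: "('i \<Rightarrow> real) set"
  assumes "finite I" "finite V"
  shows "finite (int_vectors I \<inter> {\<Sum>v\<in>V. \<mu> v *\<^sub>R v | \<mu>. \<forall>v\<in>V. 0 < \<mu> v \<and> \<mu> v \<le> s})"
proof (rule finite_subset[OF _ finite_bounded_int_vectors[OF assms(1), of "\<Sum>v\<in>V. \<Sum>i\<in>I. \<bar>s\<bar> * \<bar>v i\<bar>"]])
  show "int_vectors I \<inter> {\<Sum>v\<in>V. \<mu> v *\<^sub>R v | \<mu>. \<forall>v\<in>V. 0 < \<mu> v \<and> \<mu> v \<le> s}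
      \<subseteq> {x \<in> int_vectors I. \<forall>i. \<bar>x i\<bar> \<le> (\<Sum>v\<in>V. \<Sum>i\<in>I. \<bar>s\<bar> * \<bar>v i\<bar>)}"
  proof clarify
    fix \<mu> :: "('i \<Rightarrow> real) \<Rightarrow> real" and i
    assume x: "(\<Sum>v\<in>V. \<mu> v *\<^sub>R v) \<in> int_vectors I" and \<mu>: "\<forall>v\<in>V. 0 < \<mu> v \<and> \<mu> v \<le> s"
    show "\<bar>(\<Sum>v\<in>V. \<mu> v *\<^sub>R v) i\<bar> \<le> (\<Sum>v\<in>V. \<Sum>i\<in>I. \<bar>s\<bar> * \<bar>v i\<bar>)"
    proof (cases "i \<in> I")
      case True
      have "\<bar>(\<Sum>v\<in>V. \<mu> v *\<^sub>R v) i\<bar> \<le> (\<Sum>v\<in>V. \<bar>\<mu> v * v i\<bar>)"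
        unfolding sum_fun_apply by (simp add: sum_abs)
      also have "\<dots> \<le> (\<Sum>v\<in>V. \<bar>s\<bar> * \<bar>v i\<bar>)"
        using \<mu> by (intro sum_mono) (auto simp: abs_mult intro!: mult_right_mono)
      also have "\<dots> \<le> (\<Sum>v\<in>V. \<Sum>i\<in>I. \<bar>s\<bar> * \<bar>v i\<bar>)"
        using True assms by (intro sum_mono member_le_sum) auto
      finally show ?thesis .
    next
      case False
      then have "(\<Sum>v\<in>V. \<mu> v *\<^sub>R v) i = 0" using x by (auto simp: int_vectors_def)
      moreover have "0 \<le> (\<Sum>v\<in>V. \<Sum>i\<in>I. \<bar>s\<bar> * \<bar>v i\<bar>)" by (intro sum_nonneg) simp
      ultimately show ?thesis by simp
    qed
  qed
qed

lemma rcone_imageI: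
  assumes "inj_on v I" "\<And>i. i \<in> I \<Longrightarrow> a i > 0"
  shows "(\<Sum>i\<in>I. a i *\<^sub>R v i) \<in> rcone (v ` I)"
proof -
  have "(\<Sum>w\<in>v ` I. a (the_inv_into I v w) *\<^sub>R w) = (\<Sum>i\<in>I. a i *\<^sub>R v i)"
    using assms(1) by (subst sum.reindex) (auto simp: the_inv_into_f_f)
  moreover have "(\<Sum>w\<in>v ` I. a (the_inv_into I v w) *\<^sub>R w) \<in> rcone (v ` I)"
    using assms by (intro rconeI) (auto simp: the_inv_into_f_f)
  ultimately show ?thesis by simp
qed

text \<open>At height 1 the generators are the vertices of a simplex with corner (-N, ..., -N) and
  edges of length M = 2 N (n + 1) along the axes. In the open cube each coordinate exceeds -N by
  less than 2 N, so the barycentric coordinates along the edges sum to at most n / (n + 1) and a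
  positive weight is left for the corner.\<close>

lemma big_simplex_cone:
  fixes I :: "'i set" and N :: nat
  assumes "finite I" "h \<notin> I" "N > 0"
  obtains V where "finite V" "independent V"
    "V \<subseteq> {x. x h > 0} \<inter> int_vectors (insert h I)"
    "{x. (\<forall>i. i \<notin> insert h I \<longrightarrow> x i = 0) \<and> x h > 0 \<and> (\<forall>i\<in>I. \<bar>x i\<bar> < real N * x h)} \<subseteq> rcone V"
proof -
  define n where "n = card I"
  define M where "M = real (2 * N * (n + 1))"
  have M: "M > 0" unfolding M_def of_nat_0_less_iff using assms(3) by simp
  have Meq: "M = 2 * real N * real (n + 1)"
    unfolding M_def by (simp only: of_nat_mult of_nat_numeral)
  define v0 where "v0 = (\<lambda>j. if j = h then 1 else if j \<in> I then - real N else 0)"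
  define v where "v i = v0(i := M - real N)" for i
  have ne: "i \<noteq> h" if "i \<in> I" for i using that assms(2) by auto
  have v_apply: "v i j = v0 j + (if j = i then M else 0)" if "i \<in> I" for i j
    using that ne by (simp add: v_def v0_def)
  have inj: "inj_on v I"
  proof (rule inj_onI)
    fix i j assume ij: "i \<in> I" "j \<in> I" "v i = v j"
    then have "v0 i + M = v0 i + (if i = j then M else 0)"
      using v_apply[OF ij(1), of i] v_apply[OF ij(2), of i] by simp
    then show "i = j" using M by (simp split: if_splits)
  qed
  have v0: "v0 \<notin> v ` I"
  proof
    assume "v0 \<in> v ` I"
    then obtain i where "i \<in> I" "v0 = v i" by blast
    then have "v0 i = v0 i + M" using v_apply[of i i] by simp
    then show False using M by simp
  qed
  define V where "V = insert v0 (v ` I)"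
  have fin: "finite V" using assms(1) by (simp add: V_def)
  have sumV: "(\<Sum>w\<in>V. f w *\<^sub>R w) j = f v0 * v0 j + (\<Sum>i\<in>I. f (v i) * v i j)" for f j
    unfolding V_def sum_fun_apply using assms(1) v0 inj by (simp add: sum.reindex)
  have "independent V"
  proof (rule independent_if_scalars_zero[OF fin])
    fix f w assume zero: "(\<Sum>w\<in>V. f w *\<^sub>R w) = 0" and w: "w \<in> V"
    have coord: "f v0 * v0 j + (\<Sum>i\<in>I. f (v i) * v i j) = 0" for j
      using zero sumV[of f j] by simp
    have "(\<Sum>i\<in>I. f (v i) * v i h) = (\<Sum>i\<in>I. f (v i))"
      using v_apply ne by (intro sum.cong) (auto simp: v0_def)
    then have total: "f v0 + (\<Sum>i\<in>I. f (v i)) = 0" using coord[of h] by (simp add: v0_def)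
    have zero_i: "f (v j) = 0" if j: "j \<in> I" for j
    proof -
      have "(\<Sum>i\<in>I. f (v i) * v i j) = (\<Sum>i\<in>I. f (v i) * v0 j + (if i = j then f (v i) * M else 0))"
        using v_apply by (intro sum.cong) (auto simp: algebra_simps)
      also have "\<dots> = (\<Sum>i\<in>I. f (v i)) * v0 j + f (v j) * M"
        using j assms(1) by (simp add: sum.distrib sum_distrib_right)
      finally have "(f v0 + (\<Sum>i\<in>I. f (v i))) * v0 j + f (v j) * M = 0"
        using coord[of j] by (simp add: algebra_simps)
      then show ?thesis using total M by simp
    qed
    moreover have "f v0 = 0" using total zero_i by simp
    ultimately show "f w = 0" using w by (auto simp: V_def)
  qed
  moreover have "V \<subseteq> {x. x h > 0} \<inter> int_vectors (insert h I)"
    using ne assms(2) unfolding V_def v_def v0_def M_def int_vectors_def by auto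
  moreover have "x \<in> rcone V"
    if x: "\<forall>i. i \<notin> insert h I \<longrightarrow> x i = 0" "x h > 0" "\<forall>i\<in>I. \<bar>x i\<bar> < real N * x h" for x
  proof -
    define a where "a i = (x i + real N * x h) / M" for i
    define b where "b = x h - (\<Sum>i\<in>I. a i)"
    have a: "a i > 0" "a i \<le> x h / real (n + 1)" if "i \<in> I" for i
    proof -
      have "\<bar>x i\<bar> < real N * x h" using x(3) that by blast
      then have *: "0 < x i + real N * x h" "x i + real N * x h \<le> 2 * real N * x h" by linarith+
      then show "a i > 0" using M by (simp add: a_def)
      have "a i \<le> 2 * real N * x h / M" unfolding a_def using * M by (intro divide_right_mono) auto
      also have "\<dots> = x h / real (n + 1)" unfolding Meq using assms(3)
        by (intro mult_divide_mult_cancel_left) simp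
      finally show "a i \<le> x h / real (n + 1)" .
    qed
    have "(\<Sum>i\<in>I. a i) \<le> real n * (x h / real (n + 1))"
      unfolding n_def using a(2) unfolding n_def by (intro sum_bounded_above)
    also have "\<dots> < x h" using x(2) by (simp add: field_simps)
    finally have b: "b > 0" by (simp add: b_def)
    have "x = b *\<^sub>R v0 + (\<Sum>i\<in>I. a i *\<^sub>R v i)"
    proof
      fix j
      have "(\<Sum>i\<in>I. a i * v i j) = (\<Sum>i\<in>I. a i * v0 j + (if i = j then a i * M else 0))"
        using v_apply by (intro sum.cong) (auto simp: algebra_simps)
      also have "\<dots> = (\<Sum>i\<in>I. a i) * v0 j + (if j \<in> I then a j * M else 0)"
        using assms(1) by (simp add: sum.distrib sum_distrib_right)
      finally have "(b *\<^sub>R v0 + (\<Sum>i\<in>I. a i *\<^sub>R v i)) j = x h * v0 j + (if j \<in> I then a j * M else 0)"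
        by (simp add: sum_fun_apply b_def algebra_simps)
      also have "\<dots> = x j"
        using x(1) M ne by (auto simp: v0_def a_def)
      finally show "x j = (b *\<^sub>R v0 + (\<Sum>i\<in>I. a i *\<^sub>R v i)) j" by simp
    qed
    moreover have "(\<Sum>i\<in>I. a i *\<^sub>R v i) \<in> rcone (v ` I)"
      using inj a(1) by (rule rcone_imageI)
    ultimately show ?thesis
      unfolding V_def using rcone_insert[of "v ` I" v0 x] v0 assms(1) b by blast
  qed
  ultimately show ?thesis using that[OF fin] by blast
qed

text \<open>Integral values of \<open>g\<close> make the cut points integral combinations of
  integral vectors.\<close>

lemma cut_closed_int_vectors:
  assumes "linear g" "\<And>x. x \<in> int_vectors I \<Longrightarrow> g x \<in> \<int>"
  shows "cut_closed g ({x. x h > 0} \<inter> int_vectors I)"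
  unfolding cut_closed_def
proof (intro ballI impI)
  fix u v :: "'a \<Rightarrow> real"
  assume u: "u \<in> {x. x h > 0} \<inter> int_vectors I" and v: "v \<in> {x. x h > 0} \<inter> int_vectors I"
    and g: "g u > 0" "g v < 0"
  have "g u *\<^sub>R v - g v *\<^sub>R u \<in> {x. x h > 0}"
    using cut_closed_height[of g h] u v g unfolding cut_closed_def by blast
  moreover have "g u \<in> \<int>" "g v \<in> \<int>" using assms(2) u v by auto
  then have "g u *\<^sub>R v - g v *\<^sub>R u \<in> int_vectors I"
    using u v by (auto simp: int_vectors_def intro!: Ints_diff Ints_mult)
  ultimately show "g u *\<^sub>R v - g v *\<^sub>R u \<in> {x. x h > 0} \<inter> int_vectors I" by blast
qed

text \<open>Openness along each line, the form in which \<open>euler_sum_rel_open\<close> asks for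
  it.\<close>

lemma linear_pos_open_on_lines:
  fixes H :: "('v::real_vector \<Rightarrow> real) set"
  assumes "finite H" "\<And>g. g \<in> H \<Longrightarrow> linear g" "\<And>g. g \<in> H \<Longrightarrow> g x > 0"
  shows "\<exists>\<epsilon>>0. \<forall>s. \<bar>s\<bar> < \<epsilon> \<longrightarrow> (\<forall>g\<in>H. g (x + s *\<^sub>R u) > 0)"
  using assms
proof (induction H)
  case empty
  show ?case by (intro exI[of _ 1]) auto
next
  case (insert g H)
  then obtain \<epsilon> where \<epsilon>: "\<epsilon> > 0" "\<forall>s. \<bar>s\<bar> < \<epsilon> \<longrightarrow> (\<forall>g\<in>H. g (x + s *\<^sub>R u) > 0)" by auto
  have g: "linear g" "g x > 0" using insert.prems by auto
  define \<delta> where "\<delta> = min \<epsilon> (g x / (\<bar>g u\<bar> + 1))"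
  have "\<delta> > 0" using \<epsilon> g by (simp add: \<delta>_def add_nonneg_pos)
  moreover have "g (x + s *\<^sub>R u) > 0" if "\<bar>s\<bar> < \<delta>" for s
  proof -
    have "\<bar>g u\<bar> + 1 > 0" by linarith
    then have "\<bar>s\<bar> * (\<bar>g u\<bar> + 1) < g x" using that by (simp add: \<delta>_def pos_less_divide_eq)
    moreover have "\<bar>s * g u\<bar> \<le> \<bar>s\<bar> * (\<bar>g u\<bar> + 1)" by (simp add: abs_mult mult_left_mono)
    ultimately show ?thesis using g by (simp add: linear_add linear_scale)
  qed
  moreover have "\<delta> \<le> \<epsilon>" by (simp add: \<delta>_def)
  ultimately show ?case using \<epsilon> by (intro exI[of _ \<delta>]) auto
qed

text \<open>\<open>K\<close> is the cone over an open polytope placed at height 1, with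
  \<open>bdd\<close> its boundedness in homogeneous form. The bound puts \<open>K\<close> into one
  large simplicial cone, out of which the hyperplanes of \<open>H\<close> carve it.\<close>

theorem ehrhart_open_polytope:
  fixes I :: "'i set" and H :: "(('i \<Rightarrow> real) \<Rightarrow> real) set"
  assumes I: "finite I" "h \<notin> I" and H: "finite H"
      "\<And>g. g \<in> H \<Longrightarrow> linear g" "\<And>g x. g \<in> H \<Longrightarrow> x \<in> int_vectors (insert h I) \<Longrightarrow> g x \<in> \<int>"
    and K: "K = {x. (\<forall>i. i \<notin> insert h I \<longrightarrow> x i = 0) \<and> (\<forall>g\<in>H. g x > 0)}"
    and bdd: "\<And>x. x \<in> K \<Longrightarrow> x h > 0 \<and> (\<forall>i\<in>I. \<bar>x i\<bar> < real N * x h)"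
    and "N > 0" "K \<noteq> {}"
  shows "ehrhart (\<lambda>t. real (card {x \<in> int_vectors (insert h I) \<inter> K. x h = real t})) ((-1) ^ card I)"
proof -
  let ?\<Lambda> = "int_vectors (insert h I)"
  let ?L = "{x. x h > 0} \<inter> ?\<Lambda>"
  obtain V where V: "finite V" "independent V" "V \<subseteq> ?L"
    and big: "{x. (\<forall>i. i \<notin> insert h I \<longrightarrow> x i = 0) \<and> x h > 0 \<and> (\<forall>i\<in>I. \<bar>x i\<bar> < real N * x h)} \<subseteq> rcone V"
    by (rule big_simplex_cone[OF I \<open>N > 0\<close>])
  have "conic_partition ?L {V} (rcone V)" using V by (simp add: conic_partition_def)
  from conic_partition_halfspaces[OF H(1) this]
  have "\<exists>D. conic_partition ?L D {x\<in>rcone V. \<forall>g\<in>H. g x > 0}"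
    using H(2,3) cut_closed_int_vectors by (metis (full_types))
  then obtain D where "conic_partition ?L D {x\<in>rcone V. \<forall>g\<in>H. g x > 0}" ..
  moreover have "{x\<in>rcone V. \<forall>g\<in>H. g x > 0} = K"
  proof
    have "x i = 0" if x: "x \<in> rcone V" and i: "i \<notin> insert h I" for x i
    proof -
      have "\<forall>v\<in>V. v i = 0" using V(3) i by (auto simp: int_vectors_def)
      then show ?thesis using x by (auto simp: rcone_def sum_fun_apply intro!: sum.neutral)
    qed
    then show "{x\<in>rcone V. \<forall>g\<in>H. g x > 0} \<subseteq> K" unfolding K by blast
    show "K \<subseteq> {x\<in>rcone V. \<forall>g\<in>H. g x > 0}" using bdd big unfolding K by blast
  qed
  ultimately have D: "conic_partition ?L D K" by simp
  note D' = conic_partitionD[OF D]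
  \<comment> \<open>Integrality is dropped here, because slices at real slopes do not preserve
    it.\<close>
  have Dh: "conic_partition {x. x h > 0} D K"
    using D unfolding conic_partition_def by simp
  have K_slice: "K = {x \<in> slice_space h I {} (\<lambda>_. 0). \<forall>g\<in>H. g x > 0}"
    unfolding K slice_space_def by auto
  have "euler_sum D = - ((-1) ^ card (I - {}))"
  proof (rule euler_sum_rel_open[OF I _ Dh, of _ "\<lambda>_. 0"])
    show "K \<subseteq> slice_space h I {} (\<lambda>_. 0)" unfolding K_slice by blast
    show "x h > 0" if "x \<in> K" for x using bdd that by blast
    show "a *\<^sub>R x + b *\<^sub>R y \<in> K" if "x \<in> K" "y \<in> K" "a > 0" "b > 0" for x y a b
      using that H(2) unfolding K by (auto simp: linear_add linear_scale intro!: add_pos_pos)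
    fix x u assume x: "x \<in> K" and u: "u \<in> slice_space h I {} (\<lambda>_. 0)"
    have "\<forall>g\<in>H. g x > 0" using x unfolding K by blast
    then have "\<exists>\<epsilon>>0. \<forall>s. \<bar>s\<bar> < \<epsilon> \<longrightarrow> (\<forall>g\<in>H. g (x + s *\<^sub>R u) > 0)"
      using H(2) by (intro linear_pos_open_on_lines[OF H(1)]) auto
    moreover have "(x + s *\<^sub>R u) i = 0" if "i \<notin> insert h I" for s i
      using x u that unfolding K slice_space_def by auto
    ultimately show "\<exists>\<epsilon>>0. \<forall>s. \<bar>s\<bar> < \<epsilon> \<longrightarrow> x + s *\<^sub>R u \<in> K" unfolding K by blast
  qed (use \<open>K \<noteq> {}\<close> in auto)
  then have euler: "(\<Sum>V\<in>D. - ((-1) ^ card V)) = (-1 :: real) ^ card I"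
    by (simp add: euler_sum_def sum_negf)
  have lin: "linear (\<lambda>x :: 'i \<Rightarrow> real. x h)" by (intro linearI) auto
  have cell: "ehrhart (\<lambda>t. real (card {x \<in> ?\<Lambda> \<inter> rcone V. x h = real t})) (- ((-1) ^ card V))"
    "finite {x \<in> ?\<Lambda> \<inter> rcone V. x h = real t}" if V: "V \<in> D" for V t
  proof -
    have "V \<noteq> {}" using D'(5)[OF V] bdd[of 0] by auto
    note c = ehrhart_rcone[OF lin D'(2)[OF V] D'(3)[OF V] this, of ?\<Lambda>]
    have s: "V \<subseteq> ?\<Lambda>" "\<And>v. v \<in> V \<Longrightarrow> v h > 0" using D'(4)[OF V] by auto
    have \<Lambda>: "0 \<in> ?\<Lambda>" "\<And>x y. x \<in> ?\<Lambda> \<Longrightarrow> y \<in> ?\<Lambda> \<Longrightarrow> x + y \<in> ?\<Lambda>"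
      "\<And>x y. x \<in> ?\<Lambda> \<Longrightarrow> y \<in> ?\<Lambda> \<Longrightarrow> x - y \<in> ?\<Lambda>" "\<And>x. x \<in> ?\<Lambda> \<Longrightarrow> x h \<in> \<int>"
      by (auto simp: int_vectors_def)
    have box: "\<And>s. finite (?\<Lambda> \<inter> {\<Sum>v\<in>V. \<mu> v *\<^sub>R v | \<mu>. \<forall>v\<in>V. 0 < \<mu> v \<and> \<mu> v \<le> s})"
      using I(1) D'(2)[OF V] by (intro finite_int_vectors_box) auto
    show "ehrhart (\<lambda>t. real (card {x \<in> ?\<Lambda> \<inter> rcone V. x h = real t})) (- ((-1) ^ card V))"
      by (rule c(1); fact s \<Lambda> box)
    show "finite {x \<in> ?\<Lambda> \<inter> rcone V. x h = real t}"
      by (rule c(2); fact s \<Lambda> box)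
  qed
  have "real (card {x \<in> ?\<Lambda> \<inter> K. x h = real t}) =
      (\<Sum>V\<in>D. real (card {x \<in> ?\<Lambda> \<inter> rcone V. x h = real t}))" for t
  proof -
    have "{x \<in> ?\<Lambda> \<inter> K. x h = real t} = (\<Union>V\<in>D. {x \<in> ?\<Lambda> \<inter> rcone V. x h = real t})"
      unfolding D'(7)[symmetric] by blast
    moreover have "card \<dots> = (\<Sum>V\<in>D. card {x \<in> ?\<Lambda> \<inter> rcone V. x h = real t})"
    proof (rule card_UN_disjoint[OF D'(1)])
      show "\<forall>V\<in>D. finite {x \<in> ?\<Lambda> \<inter> rcone V. x h = real t}" using cell(2) by blast
      show "\<forall>V\<in>D. \<forall>W\<in>D. V \<noteq> W \<longrightarrow>
          {x \<in> ?\<Lambda> \<inter> rcone V. x h = real t} \<inter> {x \<in> ?\<Lambda> \<inter> rcone W. x h = real t} = {}"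
        using D'(6) by fast
    qed
    ultimately show ?thesis by (simp only: of_nat_sum)
  qed
  moreover have "ehrhart (\<lambda>t. \<Sum>V\<in>D. real (card {x \<in> ?\<Lambda> \<inter> rcone V. x h = real t})) (\<Sum>V\<in>D. - ((-1) ^ card V))"
    by (rule ehrhart_sum[OF D'(1)]) (rule cell(1))
  ultimately show ?thesis
    by (simp only: euler)
qed

section \<open>Rational polygons\<close>

lemma common_denominator:
  assumes "r1 \<in> \<rat>" "r2 \<in> \<rat>" "r3 \<in> (\<rat> :: real set)"
  obtains n m1 m2 m3 :: int where "n > 0"
    "real_of_int n * r1 = real_of_int m1" "real_of_int n * r2 = real_of_int m2" "real_of_int n * r3 = real_of_int m3"
proof -
  obtain a1 b1 where 1: "b1 > (0::int)" "r1 = real_of_int a1 / real_of_int b1"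
    using assms(1) by (auto elim!: Rats_cases')
  obtain a2 b2 where 2: "b2 > (0::int)" "r2 = real_of_int a2 / real_of_int b2"
    using assms(2) by (auto elim!: Rats_cases')
  obtain a3 b3 where 3: "b3 > (0::int)" "r3 = real_of_int a3 / real_of_int b3"
    using assms(3) by (auto elim!: Rats_cases')
  show ?thesis
  proof (rule that)
    show "b1 * b2 * b3 > 0" using 1 2 3 by simp
    show "real_of_int (b1 * b2 * b3) * r1 = real_of_int (a1 * b2 * b3)" using 1 by simp
    show "real_of_int (b1 * b2 * b3) * r2 = real_of_int (a2 * b1 * b3)" using 2 by simp
    show "real_of_int (b1 * b2 * b3) * r3 = real_of_int (a3 * b1 * b2)" using 3 by simp
  qed
qed

text \<open>The normal \<open>a\<close> is orthogonal to \<open>w - u\<close>, hence a real multiple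
  of the rational vector (p, q). The absolute value of the factor \<open>k\<close> cancels from the
  inequality, its sign \<open>s\<close> stays, and a common denominator clears the rest.\<close>

lemma rational_halfplane:
  fixes a u w :: "real \<times> real"
  assumes "a \<noteq> 0" "u \<noteq> w" "a \<bullet> u = b" "a \<bullet> w = b"
    and rat: "fst u \<in> \<rat>" "snd u \<in> \<rat>" "fst w \<in> \<rat>" "snd w \<in> \<rat>"
  shows "\<exists>\<alpha> \<beta> \<gamma> :: int. \<forall>x. a \<bullet> x < b \<longleftrightarrow>
    real_of_int \<alpha> * fst x + real_of_int \<beta> * snd x < real_of_int \<gamma>"
proof -
  define p q where "p = snd w - snd u" and "q = fst u - fst w"
  have pq: "p \<noteq> 0 \<or> q \<noteq> 0" using assms(2) by (auto simp: p_def q_def prod_eq_iff)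
  have rel: "fst a * q = snd a * p"
    using assms(3,4) by (simp add: inner_prod_def p_def q_def algebra_simps)
  obtain k where k: "fst a = k * p" "snd a = k * q"
  proof (cases "q = 0")
    case True
    then show ?thesis using rel pq that[of "fst a / p"] by auto
  next
    case False
    then show ?thesis using rel that[of "snd a / q"] by (auto simp: field_simps)
  qed
  have "k \<noteq> 0" using k \<open>a \<noteq> 0\<close> by (auto simp: prod_eq_iff)
  have b: "b = k * (p * fst u + q * snd u)"
    using assms(3) k by (simp add: inner_prod_def algebra_simps)
  define s where "s = (sgn k :: real)"
  have s: "s \<in> \<rat>" "\<bar>k\<bar> * s = k" "\<bar>k\<bar> > 0" using \<open>k \<noteq> 0\<close> by (auto simp: s_def sgn_if)
  have *: "a \<bullet> x < b \<longleftrightarrow> s * p * fst x + s * q * snd x < s * (p * fst u + q * snd u)" for x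
  proof -
    have "a \<bullet> x = \<bar>k\<bar> * (s * p * fst x + s * q * snd x)"
    proof -
      have "\<bar>k\<bar> * (s * p * fst x + s * q * snd x) = (\<bar>k\<bar> * s) * p * fst x + (\<bar>k\<bar> * s) * q * snd x"
        by (simp add: algebra_simps)
      then show ?thesis unfolding s(2) by (simp add: inner_prod_def k)
    qed
    moreover have "b = \<bar>k\<bar> * (s * (p * fst u + q * snd u))"
      using b s(2) by (simp flip: mult.assoc)
    ultimately show ?thesis using s(3) by (simp only: mult_less_cancel_left_pos)
  qed
  have "s * p \<in> \<rat>" "s * q \<in> \<rat>" "s * (p * fst u + q * snd u) \<in> \<rat>"
    using rat s(1) by (auto simp: p_def q_def)
  then obtain n \<alpha> \<beta> \<gamma> :: int where n: "n > 0" "real_of_int n * (s * p) = real_of_int \<alpha>"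
      "real_of_int n * (s * q) = real_of_int \<beta>"
      "real_of_int n * (s * (p * fst u + q * snd u)) = real_of_int \<gamma>"
    by (rule common_denominator)
  have "a \<bullet> x < b \<longleftrightarrow> real_of_int \<alpha> * fst x + real_of_int \<beta> * snd x < real_of_int \<gamma>" for x
  proof -
    have "a \<bullet> x < b \<longleftrightarrow> real_of_int n * (s * p * fst x + s * q * snd x) <
        real_of_int n * (s * (p * fst u + q * snd u))"
      unfolding * using n(1) by (simp only: mult_less_cancel_left_pos of_int_0_less_iff)
    then show ?thesis unfolding n(2-4)[symmetric] by (simp add: algebra_simps)
  qed
  then show ?thesis by blast
qed

text \<open>In the plane a facet is an edge; by Krein-Milman it has two distinct extreme points,
  which are vertices of \<open>B\<close> and so rational. Each edge line therefore has an integral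
  equation.\<close>

lemma polygon_interior_halfplanes:
  assumes "rational_convex_polygon B"
  obtains H :: "(int \<times> int \<times> int) set" where "finite H"
    "interior B = {x. \<forall>(\<alpha>, \<beta>, \<gamma>)\<in>H. real_of_int \<alpha> * fst x + real_of_int \<beta> * snd x < real_of_int \<gamma>}"
proof -
  have B: "polytope B" "aff_dim B = 2" "\<And>v. v extreme_point_of B \<Longrightarrow> fst v \<in> \<rat> \<and> snd v \<in> \<rat>"
    using assms by (auto simp: rational_convex_polygon_def)
  have hull: "affine hull B = UNIV"
    using B(2) aff_dim_eq_full[of B] by simp
  have "polyhedron B" using B(1) by (rule polytope_imp_polyhedron)
  then obtain F where F: "finite F" "B = affine hull B \<inter> \<Inter>F"
      "\<forall>h\<in>F. \<exists>a b. a \<noteq> 0 \<and> h = {x. a \<bullet> x \<le> b}"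
      "\<forall>F'. F' \<subset> F \<longrightarrow> B \<subset> affine hull B \<inter> \<Inter>F'"
    unfolding polyhedron_Int_affine_minimal by blast
  from bchoice[OF F(3)] obtain a where "\<forall>h\<in>F. \<exists>b. a h \<noteq> 0 \<and> h = {x. a h \<bullet> x \<le> b}" ..
  from bchoice[OF this] obtain b where ab: "\<forall>h\<in>F. a h \<noteq> 0 \<and> h = {x. a h \<bullet> x \<le> b h}" ..
  have rel: "rel_interior B = {x \<in> B. \<forall>h\<in>F. a h \<bullet> x < b h}"
    by (rule rel_interior_polyhedron_explicit[OF F(1,2) bspec[OF ab] F(4)[rule_format]])
  \<comment> \<open>\<open>B\<close> is full-dimensional: its relative interior is its interior, and
    membership in \<open>B\<close> follows from the strict inequalities.\<close>
  have int: "interior B = {x. \<forall>h\<in>F. a h \<bullet> x < b h}"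
  proof -
    have "x \<in> B" if "\<forall>h\<in>F. a h \<bullet> x < b h" for x
    proof -
      have "x \<in> h" if "h \<in> F" for h
        using ab \<open>\<forall>h\<in>F. a h \<bullet> x < b h\<close> that by (metis (mono_tags) less_imp_le mem_Collect_eq)
      then have "x \<in> affine hull B \<inter> \<Inter>F" using hull by simp
      then show ?thesis using F(2) by simp
    qed
    then show ?thesis
      using rel rel_interior_interior[OF hull] by blast
  qed
  have "\<exists>\<alpha> \<beta> \<gamma> :: int. \<forall>x. a h \<bullet> x < b h \<longleftrightarrow>
      real_of_int \<alpha> * fst x + real_of_int \<beta> * snd x < real_of_int \<gamma>" if h: "h \<in> F" for h
  proof -
    define C where "C = B \<inter> {x. a h \<bullet> x = b h}"
    have "C facet_of B"
      using facet_of_polyhedron_explicit[OF F(1,2), of a b C] ab F(4) h unfolding C_def by blast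
    then have C: "C face_of B" "aff_dim C = 1" using B(2) by (auto simp: facet_of_def)
    have "polytope C" using B(1) C(1) by (rule face_of_polytope_polytope)
    then have KM: "C = convex hull {x. x extreme_point_of C}"
      by (intro Krein_Milman_Minkowski polytope_imp_compact polytope_imp_convex)
    have "\<exists>u w. u extreme_point_of C \<and> w extreme_point_of C \<and> u \<noteq> w"
    proof (rule ccontr)
      assume "\<not> ?thesis"
      then have "{x. x extreme_point_of C} = {} \<or> (\<exists>u. {x. x extreme_point_of C} = {u})" by blast
      then have "C = {} \<or> (\<exists>u. C = {u})" using KM by (metis convex_hull_empty convex_hull_singleton)
      then show False using C(2) by auto
    qed
    then obtain u w where uw: "u extreme_point_of C" "w extreme_point_of C" "u \<noteq> w" by blast
    then have "u extreme_point_of B" "w extreme_point_of B" "u \<in> C" "w \<in> C"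
      using extreme_point_of_face[OF C(1)] by auto
    then show ?thesis
      using rational_halfplane[of "a h" u w "b h"] ab h uw(3) B(3) unfolding C_def by blast
  qed
  then have "\<forall>h\<in>F. \<exists>c :: int \<times> int \<times> int. \<forall>x. a h \<bullet> x < b h \<longleftrightarrow>
      (case c of (\<alpha>, \<beta>, \<gamma>) \<Rightarrow> real_of_int \<alpha> * fst x + real_of_int \<beta> * snd x < real_of_int \<gamma>)"
    by fastforce
  from bchoice[OF this] obtain c :: "_ \<Rightarrow> int \<times> int \<times> int" where c: "\<forall>h\<in>F. \<forall>x. a h \<bullet> x < b h \<longleftrightarrow>
      (case c h of (\<alpha>, \<beta>, \<gamma>) \<Rightarrow> real_of_int \<alpha> * fst x + real_of_int \<beta> * snd x < real_of_int \<gamma>)" ..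
  show ?thesis
  proof (rule that)
    show "finite (c ` F)" using F(1) by simp
    show "interior B = {x. \<forall>(\<alpha>, \<beta>, \<gamma>)\<in>c ` F. real_of_int \<alpha> * fst x + real_of_int \<beta> * snd x < real_of_int \<gamma>}"
    proof -
      have "(\<forall>h\<in>F. a h \<bullet> x < b h) \<longleftrightarrow> (\<forall>h\<in>F. case c h of (\<alpha>, \<beta>, \<gamma>) \<Rightarrow>
          real_of_int \<alpha> * fst x + real_of_int \<beta> * snd x < real_of_int \<gamma>)" for x
        by (intro ball_cong refl c[rule_format])
      then show ?thesis unfolding int by (simp only: ball_simps)
    qed
  qed
qed

section \<open>Constituents\<close>

lemma ehrhart_scale:
  assumes "ehrhart F e"
  shows "ehrhart (\<lambda>t. c * F t) (c * e)"
proof -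
  obtain P Q where "P > 0" "\<forall>t\<ge>1. F t = poly (Q (t mod P)) (real t)" "poly (Q 0) 0 = e"
    using assms unfolding ehrhart_def by blast
  then show ?thesis
    unfolding ehrhart_def by (intro exI[of _ P] conjI exI[of _ "\<lambda>r. smult c (Q r)"]) auto
qed

lemma ehrhart_quasipolynomial:
  assumes "ehrhart F e" "\<And>n. f n = F (n + 1)"
  shows "\<exists>p. quasipolynomial_with_period f p"
proof -
  obtain P Q where P: "P > 0" and Q: "\<forall>t\<ge>1. F t = poly (Q (t mod P)) (real t)"
    using assms(1) unfolding ehrhart_def by blast
  have "f n = poly (pcompose (Q ((n mod P + 1) mod P)) [:1, 1:]) (real n)" for n
    using Q assms(2) by (simp add: poly_pcompose mod_Suc_eq)
  then have "\<exists>Q :: nat \<Rightarrow> real poly. \<forall>n. f n = poly (Q (n mod P)) (real n)"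
    by (intro exI[of _ "\<lambda>r. pcompose (Q ((r + 1) mod P)) [:1, 1:]"]) simp
  then have "quasipolynomial_with_period f P"
    using P by (simp add: quasipolynomial_with_period_def)
  then show ?thesis ..
qed

text \<open>With t = n + 1, the class of n = -1 modulo \<open>P\<close> consists of the t divisible
  by \<open>P\<close>, where \<open>Q 0\<close> gives the count, and the point n = -1 becomes t = 0.
  The periods \<open>p\<close> and \<open>P\<close> may differ, so the two polynomials are compared
  on the class of -1 modulo \<open>p * P\<close>, which is still infinite.\<close>

lemma ehrhart_constituent:
  assumes "ehrhart F e" "\<And>n. f n = F (n + 1)" "quasipolynomial_with_period f p"
  shows "poly (constituent f p (-1)) (-1) = e"
proof -
  obtain P Q where P: "P > 0" and Q: "\<forall>t\<ge>1. F t = poly (Q (t mod P)) (real t)" "poly (Q 0) 0 = e"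
    using assms(1) unfolding ehrhart_def by blast
  have p: "p > 0" using assms(3) by (simp add: quasipolynomial_with_period_def)
  define C where "C = pcompose (Q 0) [:1, 1:]"
  have cong_mult: "[int n = -1] (mod int p)" "[int n = -1] (mod int P)"
    if "[int n = -1] (mod int (p * P))" for n
    using that by (auto simp: cong_iff_dvd_diff intro: dvd_mult_left dvd_mult_right)
  have "agrees_on_class f (p * P) (-1) (constituent f p (-1))"
    using agrees_on_class_constituent[OF assms(3), of "-1"] cong_mult(1)
    unfolding agrees_on_class_def by blast
  moreover have "agrees_on_class f (p * P) (-1) C"
    unfolding agrees_on_class_def
  proof (intro allI impI)
    fix n :: nat assume n: "[int n = -1] (mod int (p * P))"
    have "int P dvd int (n + 1)" using cong_mult(2)[OF n] by (simp add: cong_iff_dvd_diff add.commute)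
    then have "(n + 1) mod P = 0" by (simp only: int_dvd_int_iff mod_eq_0_iff_dvd)
    then have "f n = poly (Q 0) (real (n + 1))" using Q(1) assms(2) by simp
    then show "poly C (real n) = f n" by (simp add: C_def poly_pcompose)
  qed
  ultimately have "constituent f p (-1) = C"
    using P p by (intro agrees_on_class_unique[of "p * P" f "-1"]) simp_all
  then show ?thesis using Q(2) by (simp add: C_def poly_pcompose)
qed

lemma interior_lattice_points_iff:
  assumes "t \<ge> 1"
    and H: "interior B = {x. \<forall>(\<alpha>, \<beta>, \<gamma>)\<in>H. real_of_int \<alpha> * fst x + real_of_int \<beta> * snd x < real_of_int \<gamma>}"
  shows "z \<in> interior_lattice_points B t \<longleftrightarrow>
    (\<forall>(\<alpha>, \<beta>, \<gamma>)\<in>H. real_of_int \<alpha> * real_of_int (fst z) + real_of_int \<beta> * real_of_int (snd z) < real_of_int \<gamma> * real t)"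
proof -
  have t: "real t > 0" using assms(1) by simp
  let ?x = "(real_of_int (fst z), real_of_int (snd z))"
  have "z \<in> interior_lattice_points B t \<longleftrightarrow> ?x \<in> (\<lambda>x. real t *\<^sub>R x) ` interior B"
    by (simp add: interior_lattice_points_def)
  also have "\<dots> \<longleftrightarrow> (1 / real t) *\<^sub>R ?x \<in> interior B"
  proof
    assume "?x \<in> (\<lambda>x. real t *\<^sub>R x) ` interior B"
    then obtain y where "y \<in> interior B" "?x = real t *\<^sub>R y" by blast
    then show "(1 / real t) *\<^sub>R ?x \<in> interior B" using t by simp
  next
    assume *: "(1 / real t) *\<^sub>R ?x \<in> interior B"
    have "?x = real t *\<^sub>R ((1 / real t) *\<^sub>R ?x)" using t by simp
    then show "?x \<in> (\<lambda>x. real t *\<^sub>R x) ` interior B" using * by blast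
  qed
  also have "\<dots> \<longleftrightarrow> (\<forall>(\<alpha>, \<beta>, \<gamma>)\<in>H. real_of_int \<alpha> * real_of_int (fst z) + real_of_int \<beta> * real_of_int (snd z) < real_of_int \<gamma> * real t)"
    unfolding H mem_Collect_eq
  proof (rule ball_cong[OF refl])
    fix c assume "c \<in> H"
    obtain \<alpha> \<beta> \<gamma> where c: "c = (\<alpha>, \<beta>, \<gamma>)" by (cases c)
    show "(case c of (\<alpha>, \<beta>, \<gamma>) \<Rightarrow> real_of_int \<alpha> * fst ((1 / real t) *\<^sub>R ?x) +
        real_of_int \<beta> * snd ((1 / real t) *\<^sub>R ?x) < real_of_int \<gamma>) \<longleftrightarrow>
      (case c of (\<alpha>, \<beta>, \<gamma>) \<Rightarrow> real_of_int \<alpha> * real_of_int (fst z) +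
        real_of_int \<beta> * real_of_int (snd z) < real_of_int \<gamma> * real t)"
      using t by (simp add: c field_simps)
  qed
  finally show ?thesis .
qed

lemma finite_interior_lattice_points:
  assumes "bounded B"
  shows "finite (interior_lattice_points B t)"
proof -
  obtain b where b: "b > 0" "\<forall>x\<in>B. norm x \<le> b" using assms unfolding bounded_pos by blast
  define k where "k = \<lceil>real t * b\<rceil>"
  have "interior_lattice_points B t \<subseteq> {-k..k} \<times> {-k..k}"
  proof
    fix z assume "z \<in> interior_lattice_points B t"
    then obtain y where y: "y \<in> interior B" "(real_of_int (fst z), real_of_int (snd z)) = real t *\<^sub>R y"
      unfolding interior_lattice_points_def by blast
    then have "norm y \<le> b" using b interior_subset by blast
    then have "norm (real t *\<^sub>R y) \<le> real t * b" by (simp add: mult_left_mono)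
    then have "norm (real_of_int (fst z), real_of_int (snd z)) \<le> real t * b" by (simp only: y(2))
    then have "\<bar>real_of_int (fst z)\<bar> \<le> real t * b" "\<bar>real_of_int (snd z)\<bar> \<le> real t * b"
      using norm_fst_le[of "real_of_int (fst z)" "real_of_int (snd z)"]
        norm_snd_le[of "real_of_int (snd z)" "real_of_int (fst z)"] by simp_all
    then have "\<bar>fst z\<bar> \<le> k" "\<bar>snd z\<bar> \<le> k" unfolding k_def by linarith+
    then show "z \<in> {-k..k} \<times> {-k..k}" by (cases z) auto
  qed
  then show ?thesis by (rule finite_subset) simp
qed

lemma labelled_type_eq_iff:
  "labelled_type M q z = labelled_type M q z' \<longleftrightarrow>
    (\<forall>i\<in>{1..q}. \<forall>j\<in>{1..q}. \<forall>m\<in>M. dot (z j - z i) (perp m) > 0 \<longleftrightarrow> dot (z' j - z' i) (perp m) > 0)"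
    (is "?L \<longleftrightarrow> ?R")
proof
  assume ?L
  then have eq: "labelled_type M q z i m = labelled_type M q z' i m" for i m by simp
  have "{j \<in> {1..q}. dot (z j - z i) (perp m) > 0} = {j \<in> {1..q}. dot (z' j - z' i) (perp m) > 0}"
    if "i \<in> {1..q}" "m \<in> M" for i m
    using eq[of i m] that unfolding labelled_type_def by simp
  then show ?R by blast
next
  assume ?R
  then show ?L unfolding labelled_type_def by (intro restrict_ext) auto
qed

section \<open>Configurations\<close>

text \<open>Coordinate \<open>(0, False)\<close> carries the dilation factor, coordinates \<open>(i, False)\<close> and \<open>(i, True)\<close>
  the position of the \<open>i\<close>-th piece.\<close>

definition encode :: "nat \<Rightarrow> nat \<Rightarrow> (nat \<Rightarrow> int \<times> int) \<Rightarrow> nat \<times> bool \<Rightarrow> real" where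
  "encode q t z = (\<lambda>(i, s). if i = 0 \<and> \<not> s then real t
     else if i \<in> {1..q} then (if s then real_of_int (snd (z i)) else real_of_int (fst (z i))) else 0)"

lemma encode_simps:
  "encode q t z (0, False) = real t"
  "i \<in> {1..q} \<Longrightarrow> encode q t z (i, False) = real_of_int (fst (z i))"
  "i \<in> {1..q} \<Longrightarrow> encode q t z (i, True) = real_of_int (snd (z i))"
  by (auto simp: encode_def)

lemma encode_in_int_vectors: "encode q t z \<in> int_vectors (insert (0, False) ({1..q} \<times> UNIV))"
  by (auto simp: int_vectors_def encode_def)

lemma bij_betw_encode:
  "bij_betw (encode q t) ({1..q} \<rightarrow>\<^sub>E UNIV)
     {x \<in> int_vectors (insert (0, False) ({1..q} \<times> UNIV)). x (0, False) = real t}"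
proof (rule bij_betwI')
  fix z z' :: "nat \<Rightarrow> int \<times> int"
  assume z: "z \<in> {1..q} \<rightarrow>\<^sub>E UNIV" "z' \<in> {1..q} \<rightarrow>\<^sub>E UNIV"
  have "z = z'" if eq: "encode q t z = encode q t z'"
  proof (rule PiE_ext[OF z])
    fix i assume i: "i \<in> {1..q}"
    have "encode q t z (i, s) = encode q t z' (i, s)" for s using eq by simp
    from this[of False] this[of True] show "z i = z' i"
      unfolding encode_simps(2,3)[OF i] by (simp add: prod_eq_iff)
  qed
  then show "(encode q t z = encode q t z') = (z = z')" by blast
next
  fix z :: "nat \<Rightarrow> int \<times> int"
  show "encode q t z \<in> {x \<in> int_vectors (insert (0, False) ({1..q} \<times> UNIV)). x (0, False) = real t}"
    using encode_in_int_vectors encode_simps(1) by blast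
next
  fix x :: "nat \<times> bool \<Rightarrow> real"
  assume x: "x \<in> {x \<in> int_vectors (insert (0, False) ({1..q} \<times> UNIV)). x (0, False) = real t}"
  define z where "z = (\<lambda>i\<in>{1..q}. (\<lfloor>x (i, False)\<rfloor>, \<lfloor>x (i, True)\<rfloor>))"
  have int: "real_of_int \<lfloor>x c\<rfloor> = x c" for c
  proof -
    have "x c \<in> \<int>" using x unfolding int_vectors_def by blast
    then show ?thesis by (metis Ints_cases floor_of_int)
  qed
  have "x c = encode q t z c" for c
  proof (cases c)
    case (Pair i s)
    show ?thesis
    proof (cases "i = 0 \<and> \<not> s")
      case True
      then show ?thesis using x Pair by (simp add: encode_simps(1))
    next
      case False
      show ?thesis
      proof (cases "i \<in> {1..q}")
        case True
        then have "z i = (\<lfloor>x (i, False)\<rfloor>, \<lfloor>x (i, True)\<rfloor>)" by (simp add: z_def)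
        then show ?thesis
          using Pair int[of "(i, True)"] int[of "(i, False)"] encode_simps(2,3)[OF True, of t z]
          by (cases s) (metis fst_conv snd_conv)+
      next
        case i: False
        then have "x c = 0" using x Pair False by (auto simp: int_vectors_def)
        then show ?thesis using Pair i False by (auto simp: encode_def)
      qed
    qed
  qed
  then have "x = encode q t z" by (rule ext)
  moreover have "z \<in> {1..q} \<rightarrow>\<^sub>E UNIV" unfolding z_def by simp
  ultimately show "\<exists>z\<in>{1..q} \<rightarrow>\<^sub>E UNIV. x = encode q t z" by blast
qed

text \<open>The side \<alpha> x + \<beta> y < \<gamma> of the board for piece \<open>i\<close>,
  homogenised by the dilation factor.\<close>

definition board_form :: "nat \<Rightarrow> int \<times> int \<times> int \<Rightarrow> (nat \<times> bool \<Rightarrow> real) \<Rightarrow> real" where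
  "board_form i c x = (case c of (\<alpha>, \<beta>, \<gamma>) \<Rightarrow>
     real_of_int \<gamma> * x (0, False) - (real_of_int \<alpha> * x (i, False) + real_of_int \<beta> * x (i, True)))"

definition board_forms :: "nat \<Rightarrow> (int \<times> int \<times> int) set \<Rightarrow> ((nat \<times> bool \<Rightarrow> real) \<Rightarrow> real) set" where
  "board_forms q H = (\<lambda>(i, c). board_form i c) ` ({1..q} \<times> H)"

text \<open>The dot product of \<open>z j - z i\<close> with \<open>perp m\<close>, multiplied by
  the sign \<sigma> that the type prescribes; a type is then cut out by positivity alone.\<close>

definition attack_form :: "int \<Rightarrow> nat \<Rightarrow> nat \<Rightarrow> int \<times> int \<Rightarrow> (nat \<times> bool \<Rightarrow> real) \<Rightarrow> real" where
  "attack_form \<sigma> i j m x = real_of_int \<sigma> *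
     ((x (j, False) - x (i, False)) * real_of_int (snd m) - (x (j, True) - x (i, True)) * real_of_int (fst m))"

definition attack_forms ::
    "(int \<times> int) set \<Rightarrow> nat \<Rightarrow> (nat \<Rightarrow> int \<times> int) \<Rightarrow> ((nat \<times> bool \<Rightarrow> real) \<Rightarrow> real) set" where
  "attack_forms M q z = (\<lambda>(i, j, m). attack_form (sgn (dot (z j - z i) (perp m))) i j m) `
     {(i, j, m). i \<in> {1..q} \<and> j \<in> {1..q} \<and> i \<noteq> j \<and> m \<in> M}"

lemma ball_board_forms: "(\<forall>g\<in>board_forms q H. P g) \<longleftrightarrow> (\<forall>i\<in>{1..q}. \<forall>c\<in>H. P (board_form i c))"
  unfolding board_forms_def by auto

lemma ball_attack_forms: "(\<forall>g\<in>attack_forms M q z. P g) \<longleftrightarrow>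
    (\<forall>i\<in>{1..q}. \<forall>j\<in>{1..q}. i \<noteq> j \<longrightarrow> (\<forall>m\<in>M. P (attack_form (sgn (dot (z j - z i) (perp m))) i j m)))"
  unfolding attack_forms_def by (simp only: ball_simps) auto

lemma attack_form_encode:
  assumes "i \<in> {1..q}" "j \<in> {1..q}"
  shows "attack_form \<sigma> i j m (encode q t z) = real_of_int (\<sigma> * dot (z j - z i) (perp m))"
  using assms by (simp add: attack_form_def encode_simps dot_def perp_def)

lemma sgn_mult_pos_iff:
  fixes a b :: int
  assumes "b \<noteq> 0"
  shows "sgn b * a > 0 \<longleftrightarrow> a \<noteq> 0 \<and> (a > 0 \<longleftrightarrow> b > 0)"
  using assms by (auto simp: sgn_if)

lemma linear_forms:
  "g \<in> board_forms q H \<Longrightarrow> linear g" "g \<in> attack_forms M q z \<Longrightarrow> linear g"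
  by (auto simp: board_forms_def board_form_def attack_forms_def attack_form_def intro!: linearI simp: algebra_simps)

lemma int_valued_forms:
  assumes "x \<in> int_vectors I"
  shows "g \<in> board_forms q H \<Longrightarrow> g x \<in> \<int>" "g \<in> attack_forms M q z \<Longrightarrow> g x \<in> \<int>"
  using assms
  by (auto simp: board_forms_def board_form_def attack_forms_def attack_form_def int_vectors_def
      intro!: Ints_diff Ints_mult Ints_add)

text \<open>For distinct nonattacking pieces the dot products are nonzero, so recording where they
  are positive fixes all signs. Having the type of \<open>z0\<close> thus means lying in the same
  open region as \<open>z0\<close>.\<close>

lemma same_type_iff_forms:
  assumes H: "interior B = {x. \<forall>(\<alpha>, \<beta>, \<gamma>)\<in>H. real_of_int \<alpha> * fst x + real_of_int \<beta> * snd x < real_of_int \<gamma>}"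
    and "t \<ge> 1" and z0: "z0 \<in> nonattacking_configs M B q t0" and z: "z \<in> {1..q} \<rightarrow>\<^sub>E UNIV"
  shows "z \<in> nonattacking_configs M B q t \<and> labelled_type M q z = labelled_type M q z0 \<longleftrightarrow>
    (\<forall>g\<in>board_forms q H \<union> attack_forms M q z0. g (encode q t z) > 0)"
proof -
  have board: "(\<forall>g\<in>board_forms q H. g (encode q t z) > 0) \<longleftrightarrow> (\<forall>i\<in>{1..q}. z i \<in> interior_lattice_points B t)"
    unfolding ball_board_forms interior_lattice_points_iff[OF \<open>t \<ge> 1\<close> H]
  proof (intro ball_cong refl)
    fix i c assume "i \<in> {1..q}" "c \<in> H"
    then show "board_form i c (encode q t z) > 0 \<longleftrightarrow> (case c of (\<alpha>, \<beta>, \<gamma>) \<Rightarrow>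
        real_of_int \<alpha> * real_of_int (fst (z i)) + real_of_int \<beta> * real_of_int (snd (z i)) < real_of_int \<gamma> * real t)"
      by (cases c) (simp add: board_form_def encode_simps)
  qed
  have nz: "dot (z0 j - z0 i) (perp m) \<noteq> 0" if "i \<in> {1..q}" "j \<in> {1..q}" "i \<noteq> j" "m \<in> M" for i j m
    using z0 that by (auto simp: nonattacking_configs_def)
  have "(\<forall>g\<in>attack_forms M q z0. g (encode q t z) > 0) \<longleftrightarrow>
      (\<forall>i\<in>{1..q}. \<forall>j\<in>{1..q}. i \<noteq> j \<longrightarrow> (\<forall>m\<in>M. attack_form (sgn (dot (z0 j - z0 i) (perp m))) i j m (encode q t z) > 0))"
    by (rule ball_attack_forms)
  also have "\<dots> \<longleftrightarrow> (\<forall>i\<in>{1..q}. \<forall>j\<in>{1..q}. i \<noteq> j \<longrightarrow> (\<forall>m\<in>M. dot (z j - z i) (perp m) \<noteq> 0 \<and>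
      (dot (z j - z i) (perp m) > 0 \<longleftrightarrow> dot (z0 j - z0 i) (perp m) > 0)))"
    by (intro ball_cong refl imp_cong)
      (simp only: attack_form_encode of_int_0_less_iff, intro sgn_mult_pos_iff nz)
  also have "\<dots> \<longleftrightarrow> (\<forall>i\<in>{1..q}. \<forall>j\<in>{1..q}. i \<noteq> j \<longrightarrow> (\<forall>m\<in>M. dot (z j - z i) (perp m) \<noteq> 0)) \<and>
      labelled_type M q z = labelled_type M q z0"
  proof -
    \<comment> \<open>For \<open>i = j\<close> the product is 0 in both configurations, so the
      diagonal condition of \<open>labelled_type_eq_iff\<close> is automatic.\<close>
    have split: "(\<forall>i\<in>S. \<forall>j\<in>S. i \<noteq> j \<longrightarrow> (\<forall>m\<in>M. A i j m \<and> C i j m)) \<longleftrightarrow>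
        (\<forall>i\<in>S. \<forall>j\<in>S. i \<noteq> j \<longrightarrow> (\<forall>m\<in>M. A i j m)) \<and> (\<forall>i\<in>S. \<forall>j\<in>S. \<forall>m\<in>M. C i j m)"
      if "\<And>i m. C i i m" for S :: "nat set" and A C
    proof (intro iffI conjI ballI)
      fix i j m assume "\<forall>i\<in>S. \<forall>j\<in>S. i \<noteq> j \<longrightarrow> (\<forall>m\<in>M. A i j m \<and> C i j m)"
        and "i \<in> S" "j \<in> S" "m \<in> M"
      then show "C i j m" using that by (cases "i = j") auto
    qed auto
    show ?thesis unfolding labelled_type_eq_iff by (rule split) (simp add: dot_def)
  qed
  finally show ?thesis
    unfolding ball_Un board nonattacking_configs_def using z by (auto simp: PiE_iff)
qed

lemma finite_forms:
  assumes "finite H" "finite M"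
  shows "finite (board_forms q H)" "finite (attack_forms M q z)"
proof -
  show "finite (board_forms q H)" unfolding board_forms_def using assms(1) by simp
  have "finite {(i, j, m). i \<in> {1..q} \<and> j \<in> {1..q} \<and> i \<noteq> j \<and> m \<in> M}"
    by (rule finite_subset[of _ "{1..q} \<times> {1..q} \<times> M"]) (use assms(2) in auto)
  then show "finite (attack_forms M q z)" unfolding attack_forms_def by simp
qed

lemma ehrhart_type_count:
  assumes M: "finite M" and B: "rational_convex_polygon B"
    and "t0 \<ge> 1" and z0: "z0 \<in> nonattacking_configs M B q t0"
  shows "ehrhart (\<lambda>t. real (card {z \<in> nonattacking_configs M B q t. labelled_type M q z = labelled_type M q z0})) 1"
proof -
  let ?h = "(0, False) :: nat \<times> bool" and ?I = "{1..q} \<times> (UNIV :: bool set)"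
  obtain H where H: "finite H"
    "interior B = {x. \<forall>(\<alpha>, \<beta>, \<gamma>)\<in>H. real_of_int \<alpha> * fst x + real_of_int \<beta> * snd x < real_of_int \<gamma>}"
    by (rule polygon_interior_halfplanes[OF B])
  have "bounded B" using B by (simp add: rational_convex_polygon_def polytope_imp_bounded)
  then obtain b where b: "b > 0" "\<forall>y\<in>B. norm y \<le> b" unfolding bounded_pos by blast
  \<comment> \<open>The extra 1 makes the bound strict.\<close>
  define N where "N = nat \<lceil>b\<rceil> + 1"
  have N: "b < real N" unfolding N_def using b(1) by linarith
  \<comment> \<open>The height is itself among the forms, so that positive height is part of being
    in \<open>K\<close>.\<close>
  define G where "G = insert (\<lambda>x. x ?h) (board_forms q H \<union> attack_forms M q z0)"
  define K where "K = {x. (\<forall>c. c \<notin> insert ?h ?I \<longrightarrow> x c = 0) \<and> (\<forall>g\<in>G. g x > 0)}"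
  have enc_K: "encode q t z \<in> K \<longleftrightarrow> z \<in> nonattacking_configs M B q t \<and> labelled_type M q z = labelled_type M q z0"
    if "t \<ge> 1" "z \<in> {1..q} \<rightarrow>\<^sub>E UNIV" for t z
    using same_type_iff_forms[OF H(2) that(1) z0 that(2)] encode_in_int_vectors[of q t z] that(1)
    unfolding K_def G_def by (simp add: int_vectors_def encode_simps(1))
  have ext: "nonattacking_configs M B q t \<subseteq> {1..q} \<rightarrow>\<^sub>E UNIV" for t
    by (auto simp: nonattacking_configs_def)
  have "ehrhart (\<lambda>t. real (card {x \<in> int_vectors (insert ?h ?I) \<inter> K. x ?h = real t})) ((-1) ^ card ?I)"
  proof (rule ehrhart_open_polytope[OF _ _ _ _ _ K_def, of N])
    show "finite G" unfolding G_def using finite_forms H(1) M by blast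
    show "linear g" if "g \<in> G" for g
      using that linear_forms unfolding G_def by (auto intro: linearI)
    show "g x \<in> \<int>" if "g \<in> G" "x \<in> int_vectors (insert ?h ?I)" for g x
    proof -
      have "x ?h \<in> \<int>" using that(2) unfolding int_vectors_def by blast
      then show ?thesis using that(1) int_valued_forms[OF that(2)] unfolding G_def by auto
    qed
    show "N > 0" by (simp add: N_def)
    show "K \<noteq> {}" using enc_K[OF \<open>t0 \<ge> 1\<close>] z0 ext by blast
    fix x assume x: "x \<in> K"
    then have pos: "x ?h > 0" unfolding K_def G_def by simp
    have "\<bar>x (i, s)\<bar> < real N * x ?h" if i: "i \<in> {1..q}" for i s
    proof -
      define y where "y = (x (i, False) / x ?h, x (i, True) / x ?h)"
      have "real_of_int \<alpha> * x (i, False) + real_of_int \<beta> * x (i, True) < real_of_int \<gamma> * x ?h"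
        if c: "(\<alpha>, \<beta>, \<gamma>) \<in> H" for \<alpha> \<beta> \<gamma>
      proof -
        have "(\<lambda>x. real_of_int \<gamma> * x ?h - (real_of_int \<alpha> * x (i, False) + real_of_int \<beta> * x (i, True))) \<in> G"
          unfolding G_def board_forms_def using i c
          by (intro insertI2 UnI1 image_eqI[of _ _ "(i, \<alpha>, \<beta>, \<gamma>)"]) (auto simp: board_form_def fun_eq_iff)
        then show ?thesis using x unfolding K_def by fastforce
      qed
      then have "y \<in> interior B" unfolding H(2) y_def using pos by (auto simp: field_simps)
      then have "norm y < real N" using b(2) N interior_subset by force
      then have "\<bar>fst y\<bar> < real N" "\<bar>snd y\<bar> < real N"
        using norm_fst_le[of "fst y" "snd y"] norm_snd_le[of "snd y" "fst y"] by simp_all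
      then have "\<bar>fst y\<bar> * x ?h < real N * x ?h" "\<bar>snd y\<bar> * x ?h < real N * x ?h"
        using pos by simp_all
      moreover have "\<bar>fst y\<bar> * x ?h = \<bar>x (i, False)\<bar>" "\<bar>snd y\<bar> * x ?h = \<bar>x (i, True)\<bar>"
        using pos by (simp_all add: y_def)
      ultimately show ?thesis by (cases s) simp_all
    qed
    then show "x ?h > 0 \<and> (\<forall>c\<in>?I. \<bar>x c\<bar> < real N * x ?h)" using pos by auto
  qed auto
  \<comment> \<open>Two coordinates per piece make the dimension even, so the value is 1 and not
    -1.\<close>
  moreover have "card ?I = 2 * q" by (simp add: card_cartesian_product)
  ultimately have eh: "ehrhart (\<lambda>t. real (card {x \<in> int_vectors (insert ?h ?I) \<inter> K. x ?h = real t})) 1"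
    by simp
  have "card {z \<in> nonattacking_configs M B q t. labelled_type M q z = labelled_type M q z0} =
      card {x \<in> int_vectors (insert ?h ?I) \<inter> K. x ?h = real t}" if t: "t \<ge> 1" for t
  proof -
    let ?Z = "{z \<in> nonattacking_configs M B q t. labelled_type M q z = labelled_type M q z0}"
    note bij = bij_betw_encode[of q t]
    have "encode q t ` ?Z = {x \<in> int_vectors (insert ?h ?I) \<inter> K. x ?h = real t}"
    proof
      show "encode q t ` ?Z \<subseteq> {x \<in> int_vectors (insert ?h ?I) \<inter> K. x ?h = real t}"
      proof (rule image_subsetI)
        fix z assume z: "z \<in> ?Z"
        then have "z \<in> {1..q} \<rightarrow>\<^sub>E UNIV" using ext[of t] by blast
        then have "encode q t z \<in> K" using enc_K[OF t] z by blast
        then show "encode q t z \<in> {x \<in> int_vectors (insert ?h ?I) \<inter> K. x ?h = real t}"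
          using encode_in_int_vectors[of q t z] encode_simps(1)[of q t z] by blast
      qed
      show "{x \<in> int_vectors (insert ?h ?I) \<inter> K. x ?h = real t} \<subseteq> encode q t ` ?Z"
      proof
        fix x assume x: "x \<in> {x \<in> int_vectors (insert ?h ?I) \<inter> K. x ?h = real t}"
        then have "x \<in> encode q t ` ({1..q} \<rightarrow>\<^sub>E UNIV)"
          using bij unfolding bij_betw_def by blast
        then show "x \<in> encode q t ` ?Z" using enc_K[OF t] x by blast
      qed
    qed
    moreover have "inj_on (encode q t) ?Z"
      using bij ext[of t] unfolding bij_betw_def by (blast intro: inj_on_subset)
    ultimately show ?thesis using card_image by fastforce
  qed
  then show ?thesis using eh unfolding ehrhart_def by simp
qed

lemma labelled_types_finite:
  assumes "finite M"
  shows "finite (labelled_types M B q)"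
proof (rule finite_subset)
  show "labelled_types M B q \<subseteq> {1..q} \<rightarrow>\<^sub>E (M \<rightarrow>\<^sub>E Pow {1..q})"
    unfolding labelled_types_def labelled_type_def by auto
  show "finite ({1..q} \<rightarrow>\<^sub>E (M \<rightarrow>\<^sub>E Pow {1..q}))"
    using assms by (intro finite_PiE) auto
qed

lemma ehrhart_nonattacking_configs:
  assumes M: "basic_move_set M" and B: "rational_convex_polygon B"
  shows "ehrhart (\<lambda>t. real (card (nonattacking_configs M B q t))) (real (card (labelled_types M B q)))"
proof -
  have finM: "finite M" using M by (simp add: basic_move_set_def)
  have fin: "finite (nonattacking_configs M B q t)" for t
  proof (rule finite_subset)
    show "nonattacking_configs M B q t \<subseteq> {1..q} \<rightarrow>\<^sub>E interior_lattice_points B t"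
      unfolding nonattacking_configs_def by blast
    have "bounded B" using B by (simp add: rational_convex_polygon_def polytope_imp_bounded)
    then show "finite ({1..q} \<rightarrow>\<^sub>E interior_lattice_points B t)"
      by (intro finite_PiE finite_interior_lattice_points) auto
  qed
  \<comment> \<open>For small \<open>t\<close> a type may have no configuration; its Ehrhart value
    is 1 nevertheless, so every type is counted exactly once.\<close>
  let ?R = "\<lambda>L t. {z \<in> nonattacking_configs M B q t. labelled_type M q z = L}"
  have "real (card (nonattacking_configs M B q t)) = (\<Sum>L\<in>labelled_types M B q. real (card (?R L t)))"
    if "t \<ge> 1" for t
  proof -
    have "nonattacking_configs M B q t = (\<Union>L\<in>labelled_types M B q. ?R L t)"
      using that unfolding labelled_types_def by auto
    moreover have "card (\<Union>L\<in>labelled_types M B q. ?R L t) = (\<Sum>L\<in>labelled_types M B q. card (?R L t))"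
      by (rule card_UN_disjoint[OF labelled_types_finite[OF finM]]) (use fin in auto)
    ultimately show ?thesis by simp
  qed
  moreover have "ehrhart (\<lambda>t. \<Sum>L\<in>labelled_types M B q. real (card (?R L t))) (\<Sum>L\<in>labelled_types M B q. 1)"
  proof (rule ehrhart_sum[OF labelled_types_finite[OF finM]])
    fix L assume "L \<in> labelled_types M B q"
    then obtain t0 z0 where "t0 \<ge> 1" "z0 \<in> nonattacking_configs M B q t0" "L = labelled_type M q z0"
      unfolding labelled_types_def by auto
    then show "ehrhart (\<lambda>t. real (card (?R L t))) 1"
      using ehrhart_type_count[OF finM B] by simp
  qed
  ultimately show ?thesis
    unfolding ehrhart_def by simp
qed

section \<open>Relabelling the pieces and orbits of types\<close>

lemma nonattacking_configs_comp:
  assumes "z \<in> nonattacking_configs M B q t" "\<sigma> permutes {1..q}"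
  shows "z \<circ> \<sigma> \<in> nonattacking_configs M B q t"
proof -
  have z: "z \<in> {1..q} \<rightarrow>\<^sub>E interior_lattice_points B t"
      "\<And>i j m. i \<in> {1..q} \<Longrightarrow> j \<in> {1..q} \<Longrightarrow> i \<noteq> j \<Longrightarrow> m \<in> M \<Longrightarrow> dot (z j - z i) (perp m) \<noteq> 0"
    using assms(1) unfolding nonattacking_configs_def by blast+
  have \<sigma>: "\<sigma> i \<in> {1..q} \<longleftrightarrow> i \<in> {1..q}" for i
    using permutes_in_image[OF assms(2)] .
  have "z \<circ> \<sigma> \<in> {1..q} \<rightarrow>\<^sub>E interior_lattice_points B t"
  proof (rule PiE_I)
    fix i assume "i \<in> {1..q}"
    then show "(z \<circ> \<sigma>) i \<in> interior_lattice_points B t"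
      using PiE_mem[OF z(1)] \<sigma>[of i] by simp
  next
    fix i assume i: "i \<notin> {1..q}"
    then have "\<sigma> i \<notin> {1..q}" using \<sigma>[of i] by blast
    from PiE_arb[OF z(1) this] show "(z \<circ> \<sigma>) i = undefined" by simp
  qed
  moreover have "dot ((z \<circ> \<sigma>) j - (z \<circ> \<sigma>) i) (perp m) \<noteq> 0"
    if "i \<in> {1..q}" "j \<in> {1..q}" "i \<noteq> j" "m \<in> M" for i j m
  proof -
    have "\<sigma> i \<noteq> \<sigma> j" using that(3) permutes_inj[OF assms(2)] by (auto dest: injD)
    then show ?thesis using z(2)[of "\<sigma> i" "\<sigma> j" m] \<sigma> that by simp
  qed
  ultimately show ?thesis unfolding nonattacking_configs_def by blast
qed

text \<open>The pieces are linearly ordered by any functional \<open>\<lambda>x. dot x (perp m)\<close>, and a type records this order,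
  so a piece is determined by its rank.\<close>

lemma labelled_type_comp_inj:
  assumes z: "z \<in> nonattacking_configs M B q t" and M: "M \<noteq> {}"
    and \<sigma>: "\<sigma> permutes {1..q}" and \<tau>: "\<tau> permutes {1..q}"
    and eq: "labelled_type M q (z \<circ> \<sigma>) = labelled_type M q (z \<circ> \<tau>)"
  shows "\<sigma> = \<tau>"
proof -
  obtain m where m: "m \<in> M" using M by blast
  define f where "f i = dot (z i) (perp m)" for i
  have diff: "dot (z j - z i) (perp m) = f j - f i" for i j
    by (simp add: f_def dot_def algebra_simps)
  have ne: "f i \<noteq> f j" if "i \<in> {1..q}" "j \<in> {1..q}" "i \<noteq> j" for i j
  proof -
    have "dot (z j - z i) (perp m) \<noteq> 0" using z that m unfolding nonattacking_configs_def by blast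
    then show ?thesis unfolding diff by simp
  qed
  define rank where "rank a = card {k \<in> {1..q}. f a < f k}" for a
  have rank_less: "rank b < rank a" if "b \<in> {1..q}" "f a < f b" for a b
    unfolding rank_def by (rule psubset_card_mono) (use that in auto)
  have rank_inj: "a = b" if "a \<in> {1..q}" "b \<in> {1..q}" "rank a = rank b" for a b
    using ne[OF that(1,2)] rank_less[OF that(2), of a] rank_less[OF that(1), of b] that(3)
    by (metis less_irrefl linorder_neqE)
  have rank_perm: "rank (\<pi> i) = card {j \<in> {1..q}. f (\<pi> i) < f (\<pi> j)}" if \<pi>: "\<pi> permutes {1..q}" for \<pi> i
  proof -
    have "\<pi> ` {j \<in> {1..q}. f (\<pi> i) < f (\<pi> j)} = {k \<in> {1..q}. f (\<pi> i) < f k}"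
    proof
      show "\<pi> ` {j \<in> {1..q}. f (\<pi> i) < f (\<pi> j)} \<subseteq> {k \<in> {1..q}. f (\<pi> i) < f k}"
        using permutes_in_image[OF \<pi>] by blast
      show "{k \<in> {1..q}. f (\<pi> i) < f k} \<subseteq> \<pi> ` {j \<in> {1..q}. f (\<pi> i) < f (\<pi> j)}"
      proof
        fix k assume k: "k \<in> {k \<in> {1..q}. f (\<pi> i) < f k}"
        then obtain j where "j \<in> {1..q}" "k = \<pi> j" using permutes_image[OF \<pi>] by blast
        then show "k \<in> \<pi> ` {j \<in> {1..q}. f (\<pi> i) < f (\<pi> j)}" using k by blast
      qed
    qed
    moreover have "inj_on \<pi> {j \<in> {1..q}. f (\<pi> i) < f (\<pi> j)}"
      using permutes_inj[OF \<pi>] by (rule inj_on_subset) simp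
    ultimately show ?thesis unfolding rank_def using card_image by fastforce
  qed
  have "\<sigma> i = \<tau> i" for i
  proof (cases "i \<in> {1..q}")
    case True
    have "f (\<sigma> i) < f (\<sigma> j) \<longleftrightarrow> f (\<tau> i) < f (\<tau> j)" if "j \<in> {1..q}" for j
    proof -
      have "dot ((z \<circ> \<sigma>) j - (z \<circ> \<sigma>) i) (perp m) > 0 \<longleftrightarrow> dot ((z \<circ> \<tau>) j - (z \<circ> \<tau>) i) (perp m) > 0"
        using eq True that m unfolding labelled_type_eq_iff by blast
      then show ?thesis by (simp add: diff)
    qed
    then have "{j \<in> {1..q}. f (\<sigma> i) < f (\<sigma> j)} = {j \<in> {1..q}. f (\<tau> i) < f (\<tau> j)}" by blast
    then have "rank (\<sigma> i) = rank (\<tau> i)"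
      using rank_perm[OF \<sigma>] rank_perm[OF \<tau>] by simp
    then show ?thesis
      using rank_inj True permutes_in_image[OF \<sigma>] permutes_in_image[OF \<tau>] by blast
  next
    case False
    then show ?thesis using permutes_not_in[OF \<sigma>] permutes_not_in[OF \<tau>] by simp
  qed
  then show ?thesis by (rule ext)
qed

lemma card_labelled_types:
  assumes M: "basic_move_set M"
  shows "fact q * card (unlabelled_types M B q) = card (labelled_types M B q)"
proof -
  let ?T = "labelled_types M B q"
  let ?O = "\<lambda>L. {relabel M q \<sigma> L | \<sigma>. \<sigma> permutes {1..q}}"
  have M': "finite M" "M \<noteq> {}" using M by (auto simp: basic_move_set_def)
  \<comment> \<open>Orbits are rewritten through one configuration \<open>z\<close>: the permuted
    types are those of \<open>z \<circ> \<sigma>\<close>, so closure and freeness can be checked on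
    configurations.\<close>
  have orbit: "?O (labelled_type M q z) = {labelled_type M q (z \<circ> \<sigma>) | \<sigma>. \<sigma> permutes {1..q}}" for z
    using labelled_type_comp[of _ q M z] by metis
  have orbit_comp: "?O (labelled_type M q (z \<circ> \<pi>)) = ?O (labelled_type M q z)" if \<pi>: "\<pi> permutes {1..q}" for z \<pi>
  proof -
    have "{labelled_type M q (z \<circ> \<pi> \<circ> \<sigma>) | \<sigma>. \<sigma> permutes {1..q}} = {labelled_type M q (z \<circ> \<sigma>) | \<sigma>. \<sigma> permutes {1..q}}"
    proof
      show "{labelled_type M q (z \<circ> \<pi> \<circ> \<sigma>) | \<sigma>. \<sigma> permutes {1..q}} \<subseteq> {labelled_type M q (z \<circ> \<sigma>) | \<sigma>. \<sigma> permutes {1..q}}"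
      proof clarify
        fix \<sigma> assume "\<sigma> permutes {1..q}"
        then have "\<pi> \<circ> \<sigma> permutes {1..q}" using \<pi> by (rule permutes_compose)
        then show "\<exists>\<rho>. labelled_type M q (z \<circ> \<pi> \<circ> \<sigma>) = labelled_type M q (z \<circ> \<rho>) \<and> \<rho> permutes {1..q}"
          by (intro exI[of _ "\<pi> \<circ> \<sigma>"]) (simp add: comp_assoc)
      qed
      show "{labelled_type M q (z \<circ> \<sigma>) | \<sigma>. \<sigma> permutes {1..q}} \<subseteq> {labelled_type M q (z \<circ> \<pi> \<circ> \<sigma>) | \<sigma>. \<sigma> permutes {1..q}}"
      proof clarify
        fix \<sigma> assume "\<sigma> permutes {1..q}"
        then have "inv \<pi> \<circ> \<sigma> permutes {1..q}" using permutes_inv[OF \<pi>] by (rule permutes_compose)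
        moreover have "\<pi> \<circ> (inv \<pi> \<circ> \<sigma>) = \<sigma>" using permutes_inv_o(1)[OF \<pi>] by (simp add: comp_assoc[symmetric])
        ultimately show "\<exists>\<rho>. labelled_type M q (z \<circ> \<sigma>) = labelled_type M q (z \<circ> \<pi> \<circ> \<rho>) \<and> \<rho> permutes {1..q}"
          by (intro exI[of _ "inv \<pi> \<circ> \<sigma>"]) (simp add: comp_assoc)
      qed
    qed
    then show ?thesis unfolding orbit .
  qed
  have typeE: "\<exists>z t. t \<ge> 1 \<and> z \<in> nonattacking_configs M B q t \<and> L = labelled_type M q z" if "L \<in> ?T" for L
    using that unfolding labelled_types_def by auto
  have sub: "?O L \<subseteq> ?T" if L: "L \<in> ?T" for L
  proof -
    obtain z t where z: "t \<ge> 1" "z \<in> nonattacking_configs M B q t" "L = labelled_type M q z"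
      using typeE[OF L] by blast
    show ?thesis
      unfolding z(3) orbit labelled_types_def using nonattacking_configs_comp[OF z(2)] z(1) by auto
  qed
  have self: "L \<in> ?O L" if L: "L \<in> ?T" for L
  proof -
    obtain z where z: "L = labelled_type M q z" using typeE[OF L] by blast
    show ?thesis unfolding z orbit using permutes_id[of "{1..q}"] by (metis (mono_tags, lifting) comp_id mem_Collect_eq)
  qed
  have cover: "\<Union>(unlabelled_types M B q) = ?T"
    unfolding unlabelled_types_def using sub self by blast
  have "fact q * card (unlabelled_types M B q) = card (\<Union>(unlabelled_types M B q))"
  proof (rule card_partition)
    show "finite (unlabelled_types M B q)"
      unfolding unlabelled_types_def using labelled_types_finite[OF M'(1)] by simp
    show "finite (\<Union>(unlabelled_types M B q))"
      unfolding cover by (rule labelled_types_finite[OF M'(1)])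
  next
    fix c assume "c \<in> unlabelled_types M B q"
    then obtain L where L: "L \<in> ?T" "c = ?O L" unfolding unlabelled_types_def by blast
    obtain z t where z: "z \<in> nonattacking_configs M B q t" "L = labelled_type M q z"
      using typeE[OF L(1)] by blast
    have "c = (\<lambda>\<sigma>. labelled_type M q (z \<circ> \<sigma>)) ` {\<sigma>. \<sigma> permutes {1..q}}"
      unfolding L(2) z(2) orbit by auto
    moreover have "inj_on (\<lambda>\<sigma>. labelled_type M q (z \<circ> \<sigma>)) {\<sigma>. \<sigma> permutes {1..q}}"
      using labelled_type_comp_inj[OF z(1) M'(2)] by (intro inj_onI) auto
    ultimately have "card c = card {\<sigma>. \<sigma> permutes {1..q}}" using card_image by fastforce
    also have "\<dots> = fact q" by (rule card_permutations) simp_all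
    finally show "card c = fact q" .
  next
    fix c d assume "c \<in> unlabelled_types M B q" "d \<in> unlabelled_types M B q" "c \<noteq> d"
    then obtain L L' where L: "L \<in> ?T" "c = ?O L" "L' \<in> ?T" "d = ?O L'"
      unfolding unlabelled_types_def by blast
    obtain z z' where z: "L = labelled_type M q z" "L' = labelled_type M q z'"
      using typeE[OF L(1)] typeE[OF L(3)] by blast
    show "c \<inter> d = {}"
    proof (rule ccontr)
      assume "c \<inter> d \<noteq> {}"
      then obtain \<sigma> \<sigma>' where \<sigma>: "\<sigma> permutes {1..q}" "\<sigma>' permutes {1..q}"
        "labelled_type M q (z \<circ> \<sigma>) = labelled_type M q (z' \<circ> \<sigma>')"
        unfolding L(2,4) z orbit by auto
      have "c = d"
        unfolding L(2,4) z using orbit_comp[OF \<sigma>(1), of z] orbit_comp[OF \<sigma>(2), of z'] \<sigma>(3) by simp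
      then show False using \<open>c \<noteq> d\<close> by simp
    qed
  qed
  then show ?thesis unfolding cover .
qed

theorem theorem5p3:
  fixes M :: "(int \<times> int) set" and B :: "(real \<times> real) set" and q p :: nat
  assumes "basic_move_set M"
    and "rational_convex_polygon B"
    and "q \<ge> 1"
    and "p = quasipolynomial_period (unlabelled_count M B q)"
  shows "real (card (unlabelled_types M B q)) =
           poly (constituent (unlabelled_count M B q) p (-1)) (-1) \<and>
         real (card (labelled_types M B q)) =
           poly (constituent (labelled_count M B q) p (-1)) (-1)"
proof -
  let ?u = "unlabelled_count M B q" and ?o = "labelled_count M B q"
  have o: "ehrhart (\<lambda>t. real (card (nonattacking_configs M B q t))) (real (card (labelled_types M B q)))"
    using assms(1,2) by (rule ehrhart_nonattacking_configs)
  have u: "ehrhart (\<lambda>t. 1 / fact q * real (card (nonattacking_configs M B q t)))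
      (1 / fact q * real (card (labelled_types M B q)))"
    using o by (rule ehrhart_scale)
  have o_eq: "?o n = real (card (nonattacking_configs M B q (n + 1)))" for n
    by (simp add: labelled_count_def)
  have u_eq: "?u n = 1 / fact q * real (card (nonattacking_configs M B q (n + 1)))" for n
    by (simp add: labelled_count_def unlabelled_count_def)
  have per_u: "quasipolynomial_with_period ?u p"
    unfolding assms(4) quasipolynomial_period_def
    using ehrhart_quasipolynomial[OF u u_eq] by (rule LeastI_ex)
  then obtain Q :: "nat \<Rightarrow> real poly" where p: "p > 0" and Q: "\<And>n. ?u n = poly (Q (n mod p)) (real n)"
    unfolding quasipolynomial_with_period_def by blast
  \<comment> \<open>\<open>p\<close> is defined as the period of \<open>?u\<close>; multiplying by
    \<open>fact q\<close> carries it over to \<open>?o\<close>.\<close>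
  have "?o n = poly (smult (fact q) (Q (n mod p))) (real n)" for n
    using Q[of n] by (simp add: unlabelled_count_def field_simps)
  then have "\<exists>Q :: nat \<Rightarrow> real poly. \<forall>n. ?o n = poly (Q (n mod p)) (real n)"
    by (intro exI[of _ "\<lambda>r. smult (fact q) (Q r)"]) simp
  then have per_o: "quasipolynomial_with_period ?o p"
    using p unfolding quasipolynomial_with_period_def by simp
  have "real (card (labelled_types M B q)) = fact q * real (card (unlabelled_types M B q))"
    unfolding card_labelled_types[OF assms(1), of q B, symmetric] by simp
  then have "1 / fact q * real (card (labelled_types M B q)) = real (card (unlabelled_types M B q))"
    by simp
  then show ?thesis
    using ehrhart_constituent[OF o o_eq per_o] ehrhart_constituent[OF u u_eq per_u] by simp
qed

end
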